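(* Let $\Sigma$ be a fixed symmetric positive definite $p\times p$ matrix. Consider the set $\mathbf{X}_\Sigma$ of Wishart-distributed matrices $\mathbf{W}\sim\mathcal{W}_p(n,\Sigma)$ with this fixed $\Sigma$, parametrized by the degrees of freedom $n\ge p$ and endowed with matrix addition (the matrices being added are supposed independent). Then $(\mathbf{X}_\Sigma,+)$ forms a non-unital commutative semigroup under addition.
   Context: For a symmetric positive definite $p\times p$ matrix $\Sigma$ (with $p\ge1$), a random symmetric positive semi-definite $p\times p$ matrix $\mathbf{W}$ has the Wishart distribution with $n$ degrees of freedom and scale matrix $\Sigma$, written $\mathbf{W}\sim\mathcal{W}_p(n,\Sigma)$, if it has the density $$f_{\mathbf{W}}=\frac{1}{2^{np/2}|\Sigma|^{n/2}\Gamma_p(n/2)}\,|\mathbf{W}|^{(n-p-1)/2}e^{-\frac12\operatorname{tr}(\Sigma^{-1}\mathbf{W})},\qquad \Gamma_p\!\left(\tfrac n2\right)=\pi^{p(p-1)/4}\prod_{j=1}^p\Gamma\!\left(\tfrac n2-\tfrac{j-1}2\right),$$ where $|\cdot|$ is the determinant. For independent $\mathbf{W}_1\sim\mathcal{W}_p(n_1,\Sigma)$ and $\mathbf{W}_2\sim\mathcal{W}_p(n_2,\Sigma)$ one has $\mathbf{W}_1+\mathbf{W}_2\sim\mathcal{W}_p(n_1+n_2,\Sigma)$. "Non-unital" means that there is no identity element. *)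

theory Defs
  imports "HOL-Probability.Probability"
begin

definition pos_semidef :: "real^'p^'p \<Rightarrow> bool" where
  "pos_semidef A \<longleftrightarrow> transpose A = A \<and> (\<forall>x. 0 \<le> x \<bullet> (A *v x))"

definition pos_def :: "real^'p^'p \<Rightarrow> bool" where
  "pos_def A \<longleftrightarrow> transpose A = A \<and> (\<forall>x. x \<noteq> 0 \<longrightarrow> 0 < x \<bullet> (A *v x))"

text \<open>
  Symmetric matrices form a Lebesgue null set in the space of all matrices (if the dimension is at
  least two), so densities of symmetric random matrices refer to the Lebesgue measure in the
  \<open>p (p + 1) / 2\<close> entries on and above the diagonal. Such an entry is indexed by the unordered pair
  \<open>{i, j}\<close>, which is a singleton on the diagonal.
\<close>

definition sym_lborel :: "(real^'p^'p) measure" where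
  "sym_lborel = distr (\<Pi>\<^sub>M e \<in> {{i, j} | i j. True}. lborel) borel (\<lambda>x. \<chi> i j. x {i, j})"

definition multivariate_Gamma :: "nat \<Rightarrow> real \<Rightarrow> real" where
  "multivariate_Gamma p a =
     pi powr (real p * (real p - 1) / 4) * (\<Prod>j=1..p. Gamma (a - (real j - 1) / 2))"

definition wishart_density :: "real^'p^'p \<Rightarrow> real \<Rightarrow> real^'p^'p \<Rightarrow> real" where
  "wishart_density \<Sigma> n W =
     (let p = real CARD('p) in
      if pos_semidef W
      then 1 / (2 powr (n * p / 2) * det \<Sigma> powr (n / 2) * multivariate_Gamma CARD('p) (n / 2))
             * det W powr ((n - p - 1) / 2) * exp (- (1 / 2) * trace (matrix_inv \<Sigma> ** W))
      else 0)"

definition wishart_distributed :: "'a measure \<Rightarrow> ('a \<Rightarrow> real^'p^'p) \<Rightarrow> real \<Rightarrow> real^'p^'p \<Rightarrow> bool" where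
  "wishart_distributed M W n \<Sigma> \<longleftrightarrow>
     prob_space M \<and> (\<forall>\<omega>\<in>space M. pos_semidef (W \<omega>)) \<and>
     distributed M sym_lborel W (\<lambda>X. ennreal (wishart_density \<Sigma> n X))"

definition wishart_law :: "real^'p^'p \<Rightarrow> real \<Rightarrow> (real^'p^'p) measure" where
  "wishart_law \<Sigma> n = density sym_lborel (\<lambda>X. ennreal (wishart_density \<Sigma> n X))"

text \<open>
  The Wishart matrices with degrees of freedom in \<open>N\<close>, once as random matrices on a given
  probability space, and once up to equality in distribution. Adding independent random matrices
  is a partial operation on the former; on laws it becomes the total operation \<^const>\<open>convolution\<close>,
  which is by definition the law of the sum of two independent matrices with the given laws.
\<close>

definition wishart_matrices ::
    "'a measure \<Rightarrow> real^'p^'p \<Rightarrow> real set \<Rightarrow> ('a \<Rightarrow> real^'p^'p) set" where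
  "wishart_matrices M \<Sigma> N = {W. \<exists>n\<in>N. wishart_distributed M W n \<Sigma>}"

definition wishart_laws :: "real^'p^'p \<Rightarrow> real set \<Rightarrow> (real^'p^'p) measure set" where
  "wishart_laws \<Sigma> N = wishart_law \<Sigma> ` N"

definition comm_semigroup_on :: "'a set \<Rightarrow> ('a \<Rightarrow> 'a \<Rightarrow> 'a) \<Rightarrow> bool" where
  "comm_semigroup_on S f \<longleftrightarrow>
     (\<forall>x\<in>S. \<forall>y\<in>S. f x y \<in> S) \<and>
     (\<forall>x\<in>S. \<forall>y\<in>S. \<forall>z\<in>S. f (f x y) z = f x (f y z)) \<and>
     (\<forall>x\<in>S. \<forall>y\<in>S. f x y = f y x)"

definition unital_on :: "'a set \<Rightarrow> ('a \<Rightarrow> 'a \<Rightarrow> 'a) \<Rightarrow> bool" where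
  "unital_on S f \<longleftrightarrow> (\<exists>e\<in>S. \<forall>x\<in>S. f e x = x \<and> f x e = x)"

end

theory Submission
  imports Defs
begin

text \<open>
  The convolution of the densities of two Wishart laws is computed directly. For positive definite
  \<open>S = L L\<^sup>T\<close>, substituting \<open>X = L Y L\<^sup>T\<close> in the integral of \<open>f\<^sub>a(X) f\<^sub>b(S - X)\<close>, where
  \<open>f\<^sub>a(X) = |X|\<close> to the power \<open>a - (p + 1) / 2\<close> times \<open>exp (- tr (A X))\<close>, turns it into \<open>f\<^sub>a\<^sub>+\<^sub>b(S)\<close> times
  a constant that depends on \<open>a\<close> and \<open>b\<close> only; the constant follows by comparing total masses, which
  are given by the multivariate Gamma integral. The substitution has Jacobian \<open>|det L|\<close> to the power
  \<open>p + 1\<close>, and only for shears and one-coordinate stretches does this have to be checked, because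
  repeated Schur complements write \<open>S\<close> as \<open>L L\<^sup>T\<close> with \<open>L\<close> a product of such matrices. The same Schur
  complement reduces the Gamma integral to one-dimensional Gamma and Gaussian integrals. Finally the
  expectation of \<open>exp (- tr (\<Sigma>\<^sup>-\<^sup>1 W) / 2)\<close> is \<open>2 powr (- n p / 2)\<close>, so the laws for different degrees of
  freedom differ, and an identity element with parameter \<open>n\<close> would satisfy \<open>n + n = n\<close>.
\<close>

section \<open>Schur complements and positive definite matrices\<close>

lemma mat_mult_nth: "(A ** B) $ i $ j = (\<Sum>k\<in>UNIV. A $ i $ k * B $ k $ j)"
  by (simp add: matrix_matrix_mult_def)

lemma symmetric_nth: "transpose X = X \<Longrightarrow> X $ i $ j = X $ j $ i"
  by (simp add: transpose_def vec_eq_iff)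

section \<open>Shears and stretches: determinants and action by congruence\<close>

definition shear :: "'p \<Rightarrow> real^'p \<Rightarrow> real^'p^'p" where
  "shear k u = (\<chi> i j. (if i = j then 1 else 0) + (if j = k then u $ i else 0))"

definition stretch :: "'p \<Rightarrow> real \<Rightarrow> real^'p^'p" where
  "stretch k r = (\<chi> i j. if i = j then (if i = k then r else 1) else 0)"

lemma det_stretch: "det (stretch k r :: real^'p^'p) = r"
proof -
  have "det (stretch k r :: real^'p^'p) = (\<Prod>i\<in>UNIV. if i = k then r else 1)"
    by (subst det_diagonal) (auto simp: stretch_def)
  then show ?thesis by simp
qed

text \<open>Row \<open>k\<close> of the transposed shear is the unit row plus \<open>u\<close>.
  Since the \<open>k\<close>-th coordinate of \<open>u\<close> vanishes, \<open>u\<close> is a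
  combination of the other unit rows, and adding such a combination to a row preserves the
  determinant.\<close>

lemma det_shear:
  assumes "u $ k = 0"
  shows "det (shear k u :: real^'p^'p) = 1"
proof -
  have span: "u \<in> vec.span {row j (mat 1 :: real^'p^'p) | j. j \<noteq> k}"
  proof -
    have "u = (\<Sum>j\<in>UNIV. u $ j *s axis j 1)"
      by (simp add: vec_eq_iff axis_def if_distrib cong: if_cong)
    also have "\<dots> = (\<Sum>j\<in>UNIV - {k}. u $ j *s axis j 1)"
      using assms by (simp add: sum.remove[of UNIV k] vec_eq_iff)
    also have "\<dots> \<in> vec.span {row j (mat 1 :: real^'p^'p) | j. j \<noteq> k}"
    proof (rule vec.span_sum)
      fix j assume "j \<in> UNIV - {k}"
      then have "axis j 1 \<in> {row j (mat 1 :: real^'p^'p) | j. j \<noteq> k}"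
        by (auto simp: row_def mat_def axis_def vec_eq_iff)
      then show "u $ j *s axis j 1 \<in> vec.span {row j (mat 1 :: real^'p^'p) | j. j \<noteq> k}"
        by (intro vec.span_scale vec.span_base)
    qed
    finally show ?thesis .
  qed
  have "det (transpose (shear k u)) =
      det (\<chi> m. if m = k then row k (mat 1) + u else row m (mat 1 :: real^'p^'p))"
    by (rule arg_cong[of _ _ det])
       (auto simp: vec_eq_iff shear_def transpose_def row_def mat_def)
  also have "\<dots> = det (mat 1 :: real^'p^'p)"
    using span by (rule det_row_span)
  finally show ?thesis by (simp add: det_transpose)
qed

lemma shear_congruence:
  fixes X :: "real^'p^'p"
  shows "(shear k u ** X ** transpose (shear k u)) $ i $ j =
    X $ i $ j + u $ i * X $ k $ j + u $ j * X $ i $ k + u $ i * u $ j * X $ k $ k"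
proof -
  have l: "(shear k u ** Y) $ i $ j = Y $ i $ j + u $ i * Y $ k $ j" for Y :: "real^'p^'p" and i j
    by (simp add: mat_mult_nth shear_def distrib_right sum.distrib mult_delta_left)
  have r: "(Y ** transpose (shear k u)) $ i $ j = Y $ i $ j + u $ j * Y $ i $ k" for Y :: "real^'p^'p" and i j
    by (simp add: mat_mult_nth shear_def transpose_def distrib_left sum.distrib mult_delta_right)
  show ?thesis by (simp add: l r algebra_simps)
qed

lemma stretch_congruence:
  fixes X :: "real^'p^'p"
  shows "(stretch k r ** X ** transpose (stretch k r)) $ i $ j =
    (if i = k then r else 1) * (if j = k then r else 1) * X $ i $ j"
proof -
  have l: "(stretch k r ** Y) $ i $ j = (if i = k then r else 1) * Y $ i $ j" for Y :: "real^'p^'p" and i j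
    by (simp add: mat_mult_nth stretch_def mult_delta_left)
  have r: "(Y ** transpose (stretch k r)) $ i $ j = (if j = k then r else 1) * Y $ i $ j" for Y :: "real^'p^'p" and i j
    by (simp add: mat_mult_nth stretch_def transpose_def mult_delta_right)
  show ?thesis by (simp add: l r)
qed

section \<open>Positive definiteness under congruence\<close>

lemma matrix_vector_mult_nonzero:
  fixes A :: "real^'p^'p"
  assumes "det A \<noteq> 0" "x \<noteq> 0"
  shows "A *v x \<noteq> 0"
proof -
  have "\<exists>B. B ** A = mat 1"
    using assms(1) invertible_det_nz[of A] by (auto simp: invertible_def)
  then show ?thesis using assms(2) by (auto simp: matrix_left_invertible_ker)
qed

lemma inner_transpose_mult:
  fixes A :: "real^'p^'p"
  shows "(transpose A *v x) \<bullet> y = x \<bullet> (A *v y)"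
  by (simp add: transpose_matrix_vector dot_lmul_matrix)

text \<open>The quadratic form of \<open>L ** X ** transpose L\<close> at \<open>x\<close> is that
  of \<open>X\<close> at \<open>transpose L *v x\<close>, a nonzero vector if \<open>x\<close> is
  one. The converse is the same argument for the inverse of \<open>L\<close>.\<close>

lemma pos_def_congruence:
  fixes X :: "real^'p^'p"
  assumes "det L \<noteq> 0"
  shows "pos_def (L ** X ** transpose L) \<longleftrightarrow> pos_def X"
proof -
  have one: "pos_def (L ** X ** transpose L)" if "pos_def X" "det L \<noteq> 0" for L X :: "real^'p^'p"
    unfolding pos_def_def
  proof (intro conjI allI impI)
    show "transpose (L ** X ** transpose L) = L ** X ** transpose L"
      using that(1) by (simp add: pos_def_def matrix_transpose_mul matrix_mul_assoc)
    fix x :: "real^'p" assume "x \<noteq> 0"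
    have "det (transpose L) \<noteq> 0" using that by (simp add: det_transpose)
    then have "transpose L *v x \<noteq> 0"
      using \<open>x \<noteq> 0\<close> by (rule matrix_vector_mult_nonzero)
    then have "0 < (transpose L *v x) \<bullet> (X *v (transpose L *v x))"
      using that by (simp add: pos_def_def)
    also have "\<dots> = x \<bullet> ((L ** X ** transpose L) *v x)"
      by (simp add: dot_lmul_matrix matrix_vector_mul_assoc[symmetric])
    finally show "0 < x \<bullet> ((L ** X ** transpose L) *v x)" .
  qed
  obtain K where K: "K ** L = mat 1" "L ** K = mat 1"
    using assms invertible_det_nz[of L] by (auto simp: invertible_def)
  then have "det K * det L = 1" by (metis det_I det_mul)
  then have "det K \<noteq> 0" by auto
  moreover have "K ** (L ** X ** transpose L) ** transpose K = X"
  proof -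
    have "K ** (L ** X ** transpose L) ** transpose K = (K ** L) ** X ** transpose (K ** L)"
      by (simp add: matrix_transpose_mul matrix_mul_assoc)
    then show ?thesis by (simp add: K transpose_mat)
  qed
  ultimately show ?thesis
    using one[of X L] one[of "L ** X ** transpose L" K] assms by auto
qed

text \<open>
  Dimensions are types, so the induction over the size of a matrix runs over sets \<open>J\<close> of indices; the
  part outside \<open>J\<close> is filled up with the identity matrix.
\<close>

definition principal_block :: "'p set \<Rightarrow> real^'p^'p \<Rightarrow> real^'p^'p" where
  "principal_block J X = (\<chi> i j. if i \<in> J \<and> j \<in> J then X $ i $ j else if i = j then 1 else 0)"

text \<open>The Schur complement of the pivot \<open>X $ k $ k\<close>, kept at full size: if the
  pivot is nonzero, row and column \<open>k\<close> become zero instead of being deleted.\<close>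

definition schur :: "'p \<Rightarrow> real^'p^'p \<Rightarrow> real^'p^'p" where
  "schur k X = (\<chi> i j. X $ i $ j - X $ i $ k * X $ k $ j / X $ k $ k)"

text \<open>One step of the Cholesky decomposition. For \<open>k\<close> outside \<open>J\<close>,
  column \<open>k\<close> holds the square root of the pivot at \<open>k\<close> and
  \<open>X $ i $ k\<close> divided by that root at each \<open>i\<close> in
  \<open>J\<close>.\<close>

definition schur_factor :: "'p set \<Rightarrow> 'p \<Rightarrow> real^'p^'p \<Rightarrow> real^'p^'p" where
  "schur_factor J k X =
     shear k (\<chi> i. if i \<in> J then X $ i $ k / X $ k $ k else 0) ** stretch k (sqrt (X $ k $ k))"

lemma det_schur_factor: "k \<notin> J \<Longrightarrow> det (schur_factor J k X) = sqrt (X $ k $ k)"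
  by (simp add: schur_factor_def det_mul det_shear det_stretch)

text \<open>Block elimination: the stretch installs the pivot, and the shear restores row and column
  \<open>k\<close> and adds back the rank one matrix that the Schur complement subtracts.\<close>

lemma principal_block_insert:
  assumes "transpose X = X" "k \<notin> J" "0 < X $ k $ k"
  shows "principal_block (insert k J) X =
    schur_factor J k X ** principal_block J (schur k X) ** transpose (schur_factor J k X)"
proof -
  have sym: "X $ i $ j = X $ j $ i" for i j
    by (rule symmetric_nth[OF assms(1)])
  let ?D = "stretch k (sqrt (X $ k $ k)) ** principal_block J (schur k X) ** transpose (stretch k (sqrt (X $ k $ k)))"
  \<comment> \<open>Row and column \<open>k\<close> of the block are padding because
    \<open>k\<close> is not in \<open>J\<close>, so the stretch only turns the 1 at position
    (\<open>k\<close>, \<open>k\<close>) into the pivot.\<close>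
  have D: "?D $ i $ j = (if i = k \<and> j = k then X $ k $ k else principal_block J (schur k X) $ i $ j)" for i j
    using assms by (auto simp: stretch_congruence principal_block_def)
  have "schur_factor J k X ** principal_block J (schur k X) ** transpose (schur_factor J k X) =
     shear k (\<chi> i. if i \<in> J then X $ i $ k / X $ k $ k else 0) ** ?D **
     transpose (shear k (\<chi> i. if i \<in> J then X $ i $ k / X $ k $ k else 0))"
    by (simp add: schur_factor_def matrix_transpose_mul matrix_mul_assoc)
  also have "\<dots> = principal_block (insert k J) X"
    unfolding vec_eq_iff
  proof (intro allI)
    fix i j
    show "(shear k (\<chi> i. if i \<in> J then X $ i $ k / X $ k $ k else 0) ** ?D **
      transpose (shear k (\<chi> i. if i \<in> J then X $ i $ k / X $ k $ k else 0))) $ i $ j =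
      principal_block (insert k J) X $ i $ j"
      using assms(2,3) sym[of k i] sym[of k j]
      unfolding shear_congruence D
      by (cases "i = k"; cases "j = k"; cases "i \<in> J"; cases "j \<in> J"; cases "i = j")
         (simp_all add: principal_block_def schur_def)
  qed
  finally show ?thesis ..
qed

lemma pos_def_diag: "pos_def X \<Longrightarrow> 0 < X $ k $ k"
proof -
  assume "pos_def X"
  then have "0 < axis k 1 \<bullet> (X *v axis k 1)"
    unfolding pos_def_def by (simp add: axis_eq_0_iff)
  then show ?thesis
    by (simp add: inner_axis' matrix_vector_mul_component inner_axis)
qed

text \<open>For a positive pivot this is congruence by the invertible Schur factor. Otherwise the
  pivot is a nonpositive diagonal entry of the larger block, so both sides fail.\<close>

lemma pos_def_principal_block_insert:
  assumes "transpose X = X" "k \<notin> J"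
  shows "pos_def (principal_block (insert k J) X) \<longleftrightarrow> 0 < X $ k $ k \<and> pos_def (principal_block J (schur k X))"
proof (cases "0 < X $ k $ k")
  case True
  then show ?thesis using assms
    by (simp add: principal_block_insert pos_def_congruence det_schur_factor)
next
  case False
  then show ?thesis using pos_def_diag[of "principal_block (insert k J) X" k]
    by (auto simp: principal_block_def)
qed

lemma transpose_schur: "transpose X = X \<Longrightarrow> transpose (schur k X) = schur k X"
  by (simp add: vec_eq_iff transpose_def schur_def mult.commute)

lemma det_principal_block_insert:
  assumes "transpose X = X" "k \<notin> J" "0 < X $ k $ k"
  shows "det (principal_block (insert k J) X) = X $ k $ k * det (principal_block J (schur k X))"
  using assms by (simp add: principal_block_insert det_mul det_transpose det_schur_factor)

section \<open>Cholesky factors as products of shears and stretches\<close>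

inductive_set elementary_products :: "(real^'p^'p) set" where
  one: "mat 1 \<in> elementary_products"
| shear: "u $ k = 0 \<Longrightarrow> L \<in> elementary_products \<Longrightarrow> shear k u ** L \<in> elementary_products"
| stretch: "r \<noteq> 0 \<Longrightarrow> L \<in> elementary_products \<Longrightarrow> stretch k r ** L \<in> elementary_products"

text \<open>Cholesky decomposition by induction over \<open>J\<close>: the Schur complement is
  factored by the induction hypothesis, and \<open>schur_factor J k X\<close>, itself a shear times
  a stretch, is put in front. For empty \<open>J\<close> only the identity padding remains.\<close>

lemma principal_block_factorization:
  assumes "finite J" "transpose X = X" "pos_def (principal_block J X)"
  shows "\<exists>L\<in>elementary_products. principal_block J X = L ** transpose L"
  using assms
proof (induction J arbitrary: X)
  case empty
  have "principal_block {} X = mat 1" by (simp add: principal_block_def mat_def)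
  then show ?case
    by (intro bexI[of _ "mat 1"]) (simp_all add: transpose_mat elementary_products.one)
next
  case (insert k J)
  have pos: "0 < X $ k $ k" "pos_def (principal_block J (schur k X))"
    using insert by (simp_all add: pos_def_principal_block_insert)
  then obtain L where L: "L \<in> elementary_products" "principal_block J (schur k X) = L ** transpose L"
    using insert transpose_schur by metis
  have "schur_factor J k X ** L \<in> elementary_products"
    using L(1) pos(1) insert.hyps
    by (auto simp: schur_factor_def matrix_mul_assoc[symmetric] intro!: elementary_products.intros)
  moreover have "principal_block (insert k J) X = (schur_factor J k X ** L) ** transpose (schur_factor J k X ** L)"
    using insert pos by (simp add: principal_block_insert L(2) matrix_transpose_mul matrix_mul_assoc)
  ultimately show ?case by blast
qed

lemma principal_block_UNIV [simp]: "principal_block UNIV X = X"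
  by (simp add: principal_block_def vec_eq_iff)

lemma pos_def_factorization:
  assumes "pos_def X"
  obtains L where "L \<in> elementary_products" "X = L ** transpose L"
  using principal_block_factorization[of UNIV X] assms by (auto simp: pos_def_def)

lemma det_elementary_products: "L \<in> elementary_products \<Longrightarrow> det L \<noteq> 0"
  by (induction rule: elementary_products.induct) (simp_all add: det_mul det_shear det_stretch)

lemma det_pos_def_pos:
  assumes "pos_def X"
  shows "0 < det X"
proof -
  obtain L where "L \<in> elementary_products" "X = L ** transpose L"
    using assms pos_def_factorization by blast
  then show ?thesis
    using det_elementary_products[of L]
    by (auto simp: det_mul det_transpose zero_less_mult_iff linorder_neq_iff)
qed

section \<open>Semidefinite and definite matrices, and measurability\<close>

lemma pos_def_imp_pos_semidef: "pos_def X \<Longrightarrow> pos_semidef X"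
  unfolding pos_def_def pos_semidef_def by (metis inner_zero_left less_eq_real_def)

lemma pos_semidef_add: "pos_semidef X \<Longrightarrow> pos_semidef Y \<Longrightarrow> pos_semidef (X + Y)"
  unfolding pos_semidef_def
  by (simp add: transpose_def vec_eq_iff matrix_vector_mult_add_rdistrib inner_add_right)

lemma pos_def_add:
  assumes "pos_def X" "pos_def Y"
  shows "pos_def (X + Y)"
proof -
  have "transpose (X + Y) = X + Y"
    using pos_semidef_add[of X Y] assms pos_def_imp_pos_semidef by (auto simp: pos_semidef_def)
  then show ?thesis
    using assms unfolding pos_def_def
    by (simp add: matrix_vector_mult_add_rdistrib inner_add_right add_pos_pos)
qed

lemma pos_def_scaleR: "0 < c \<Longrightarrow> pos_def X \<Longrightarrow> pos_def (c *\<^sub>R X)"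
  unfolding pos_def_def
  by (simp add: transpose_def vec_eq_iff scaleR_matrix_vector_assoc[symmetric])

text \<open>Links the semidefinite support of the density to the positive definite matrices used in
  the integrals. If the form vanishes at some nonzero \<open>x\<close>, then
  \<open>y = X *v x\<close> is nonzero, and moving from \<open>x\<close> a little in the direction
  of \<open>- y\<close> makes the form negative.\<close>

lemma pos_def_iff: "pos_def X \<longleftrightarrow> pos_semidef X \<and> det X \<noteq> 0"
proof
  assume "pos_def X"
  then show "pos_semidef X \<and> det X \<noteq> 0"
    using det_pos_def_pos pos_def_imp_pos_semidef by fastforce
next
  assume X: "pos_semidef X \<and> det X \<noteq> 0"
  have "0 < x \<bullet> (X *v x)" if "x \<noteq> 0" for x
  proof (rule ccontr)
    assume "\<not> 0 < x \<bullet> (X *v x)"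
    with X have 0: "x \<bullet> (X *v x) = 0"
      by (auto simp: pos_semidef_def not_less intro: antisym)
    define y where "y = X *v x"
    have "y \<noteq> 0"
      unfolding y_def using X that by (intro matrix_vector_mult_nonzero) simp_all
    have "x \<bullet> (X *v y) = y \<bullet> y"
      using X inner_transpose_mult[of X x y] by (simp add: y_def pos_semidef_def)
    moreover have "y \<bullet> (X *v x) = y \<bullet> y" by (simp add: y_def)
    ultimately have expand: "(x + t *\<^sub>R y) \<bullet> (X *v (x + t *\<^sub>R y)) =
        2 * t * (y \<bullet> y) + t\<^sup>2 * (y \<bullet> (X *v y))" for t
      using 0 by (simp add: matrix_vector_right_distrib matrix_vector_mult_scaleR inner_add_left
          inner_add_right algebra_simps power2_eq_square)
    define q where "q = y \<bullet> (X *v y)"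
    define n where "n = y \<bullet> y"
    have "0 < n" using \<open>y \<noteq> 0\<close> by (simp add: n_def)
    have "0 \<le> q" using X by (simp add: q_def pos_semidef_def)
    have "0 \<le> 2 * t * n + t\<^sup>2 * q" for t
      using X expand[of t] unfolding pos_semidef_def n_def q_def by metis
    \<comment> \<open>At this \<open>t\<close> the form is at most
      \<open>- n\<^sup>2 / (q + 1)\<close>, which is negative. The summand 1 keeps the denominator
      positive when \<open>q\<close> is zero.\<close>
    from this[of "- n / (q + 1)"] have "0 \<le> - (2 * n\<^sup>2 / (q + 1)) + n\<^sup>2 / (q+1) * (q / (q + 1))"
      by (simp add: power2_eq_square power_divide)
    moreover have "n\<^sup>2 / (q+1) * (q / (q + 1)) \<le> n\<^sup>2 / (q+1) * 1"
      using \<open>0 \<le> q\<close> by (intro mult_left_mono) auto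
    moreover have "0 < n\<^sup>2 / (q+1)" using \<open>0 < n\<close> \<open>0 \<le> q\<close> by simp
    ultimately show False by (simp)
  qed
  then show "pos_def X" using X by (simp add: pos_def_def pos_semidef_def)
qed

text \<open>Closedness yields Borel measurability although the condition ranges over uncountably
  many vectors; an arbitrary intersection of closed sets is closed.\<close>

lemma closed_pos_semidef: "closed {X :: real^'p^'p. pos_semidef X}"
proof -
  have "{X :: real^'p^'p. pos_semidef X} =
      (\<Inter>i. \<Inter>j. {X. X $ j $ i = X $ i $ j}) \<inter> (\<Inter>x. {X. 0 \<le> x \<bullet> (X *v x)})"
    by (auto simp: pos_semidef_def transpose_def vec_eq_iff)
  also have "closed \<dots>"
    unfolding matrix_vector_mult_def inner_vec_def
    by (intro closed_Int closed_INT ballI closed_Collect_eq closed_Collect_le continuous_intros)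
  finally show ?thesis .
qed

lemma continuous_on_det: "continuous_on UNIV (det :: real^'p^'p \<Rightarrow> real)"
  unfolding det_def by (intro continuous_intros)

lemma borel_measurable_det [measurable]: "(det :: real^'p^'p \<Rightarrow> real) \<in> borel_measurable borel"
  by (intro borel_measurable_continuous_onI continuous_on_det)

lemma pred_pos_def [measurable]: "Measurable.pred borel (pos_def :: real^'p^'p \<Rightarrow> bool)"
proof -
  have [measurable]: "Measurable.pred borel (pos_semidef :: real^'p^'p \<Rightarrow> bool)"
    using borel_closed[OF closed_pos_semidef] by (simp add: pred_def)
  show ?thesis unfolding pos_def_iff by measurable
qed

section \<open>Congruence transformations of symmetric matrices\<close>

text \<open>Unordered pairs with loops allowed, one for each independent entry of the symmetric
  block over \<open>J\<close>. For \<open>J = UNIV\<close> this is the index set in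
  \<open>sym_lborel\<close>.\<close>

definition edges :: "'p set \<Rightarrow> 'p set set" where
  "edges J = {{i, j} | i j. i \<in> J \<and> j \<in> J}"

definition sym_matrix :: "('p set \<Rightarrow> real) \<Rightarrow> real^'p^'p" where
  "sym_matrix x = (\<chi> i j. x {i, j})"

text \<open>Only meaningful for symmetric \<open>Q\<close>: the entry at either orientation of the edge \<open>e\<close>.\<close>

definition entry :: "real^'p^'p \<Rightarrow> 'p set \<Rightarrow> real" where
  "entry Q e = (SOME r. \<exists>i j. e = {i, j} \<and> r = Q $ i $ j)"

abbreviation edge_measure :: "'p set \<Rightarrow> ('p set \<Rightarrow> real) measure" where
  "edge_measure J \<equiv> \<Pi>\<^sub>M e \<in> edges J. lborel"

lemma sym_matrix_nth [simp]: "sym_matrix x $ i $ j = x {i, j}"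
  by (simp add: sym_matrix_def)

lemma transpose_sym_matrix [simp]: "transpose (sym_matrix x) = sym_matrix x"
  by (simp add: vec_eq_iff transpose_def insert_commute)

lemma entry_doubleton:
  assumes "\<And>i j. Q $ i $ j = Q $ j $ i"
  shows "entry Q {i, j} = Q $ i $ j"
  unfolding entry_def
proof (rule someI2)
  show "\<exists>i' j'. {i, j} = {i', j'} \<and> Q $ i $ j = Q $ i' $ j'" by blast
  fix r assume "\<exists>i' j'. {i, j} = {i', j'} \<and> r = Q $ i' $ j'"
  then show "r = Q $ i $ j" using assms by (auto simp: doubleton_eq_iff)
qed

lemma finite_edges [simp]: "finite (edges (J :: 'p::finite set))"
  by (rule finite_subset[of _ UNIV]) simp_all

lemma edges_empty [simp]: "edges {} = {}"
  by (simp add: edges_def)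

lemma doubleton_in_edges [simp]: "{i, j} \<in> edges J \<longleftrightarrow> i \<in> J \<and> j \<in> J"
  by (auto simp: edges_def doubleton_eq_iff)

lemma singleton_in_edges [simp]: "{i} \<in> edges J \<longleftrightarrow> i \<in> J"
  using doubleton_in_edges[of i i J] by simp

text \<open>The new edges form the star of \<open>k\<close>: its loop indexes the pivot, its other
  edges the row of the pivot. This is the splitting of coordinates that matches a Schur
  complement.\<close>

lemma edges_insert: "edges (insert k J) = insert {k} ((\<lambda>j. {k, j}) ` J) \<union> edges J"
proof
  show "edges (insert k J) \<subseteq> insert {k} ((\<lambda>j. {k, j}) ` J) \<union> edges J"
  proof
    fix e assume "e \<in> edges (insert k J)"
    then obtain i j where "e = {i, j}" "i \<in> insert k J" "j \<in> insert k J"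
      by (auto simp: edges_def)
    then show "e \<in> insert {k} ((\<lambda>j. {k, j}) ` J) \<union> edges J"
      by (auto simp: insert_commute)
  qed
  show "insert {k} ((\<lambda>j. {k, j}) ` J) \<union> edges J \<subseteq> edges (insert k J)"
    by (auto simp: edges_def)
qed

lemma edges_star_disjoint: "k \<notin> J \<Longrightarrow> insert {k} ((\<lambda>j. {k, j}) ` J) \<inter> edges J = {}"
  by (auto simp: edges_def doubleton_eq_iff)

lemma inj_on_star: "inj_on (\<lambda>j. {k, j}) J"
  by (auto simp: inj_on_def doubleton_eq_iff)

lemma edges_UNIV:
  fixes k :: "'p::finite"
  shows "edges UNIV = insert {k} ((\<lambda>j. {k, j}) ` (UNIV - {k})) \<union> edges (UNIV - {k})"
  by (metis Diff_insert_absorb Diff_iff edges_insert insertI1 insert_Diff iso_tuple_UNIV_I)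

lemma borel_measurable_matrixI:
  fixes F :: "'a \<Rightarrow> real^'p^'p"
  assumes "\<And>i j. (\<lambda>x. F x $ i $ j) \<in> borel_measurable M"
  shows "F \<in> borel_measurable M"
  unfolding borel_measurable_euclidean_space[of F]
  using assms by (auto simp: Basis_vec_def inner_axis)

lemma measurable_sym_matrix [measurable]:
  "sym_matrix \<in> borel_measurable (edge_measure (UNIV :: 'p::finite set))"
  by (rule borel_measurable_matrixI) simp

lemma measurable_congruence [measurable]:
  fixes L :: "real^'p^'p"
  shows "(\<lambda>X. L ** X ** K) \<in> borel_measurable borel"
  unfolding matrix_matrix_mult_def
  by (intro borel_measurable_continuous_onI continuous_intros)

lemma sym_lborel_eq: "sym_lborel = distr (edge_measure UNIV) borel sym_matrix"
  by (simp add: sym_lborel_def edges_def sym_matrix_def[abs_def])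

lemma sets_sym_lborel [simp, measurable_cong]: "sets sym_lborel = sets borel"
  by (simp add: sym_lborel_def)

lemma space_sym_lborel [simp]: "space sym_lborel = UNIV"
  by (simp add: sym_lborel_def)

lemma nn_integral_sym_lborel:
  assumes "f \<in> borel_measurable borel"
  shows "(\<integral>\<^sup>+X. f X \<partial>sym_lborel) = (\<integral>\<^sup>+x. f (sym_matrix x) \<partial>edge_measure UNIV)"
  using assms by (simp add: sym_lborel_eq nn_integral_distr)

section \<open>Changes of variables for finite products of Lebesgue measure\<close>

lemma product_sigma_finite_lborel: "product_sigma_finite (\<lambda>_. lborel :: real measure)"
  by (simp add: product_sigma_finite_def lborel.sigma_finite_measure_axioms)

text \<open>Tonelli splits off one coordinate at a time, and the one-dimensional substitution there
  contributes \<open>\<bar>c k\<bar>\<close>. The new point is written with a restricted lambda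
  because points of the product space are \<open>undefined\<close> outside the index set.\<close>

lemma nn_integral_PiM_affine:
  fixes c t :: "'i \<Rightarrow> real"
  assumes "finite I" "\<And>i. i \<in> I \<Longrightarrow> c i \<noteq> 0" "f \<in> borel_measurable (\<Pi>\<^sub>M i \<in> I. lborel)"
  shows "(\<integral>\<^sup>+x. f x \<partial>(\<Pi>\<^sub>M i \<in> I. lborel)) =
    ennreal (\<Prod>i\<in>I. \<bar>c i\<bar>) * (\<integral>\<^sup>+x. f (\<lambda>i\<in>I. t i + c i * x i) \<partial>(\<Pi>\<^sub>M i \<in> I. lborel))"
  using assms
proof (induction I arbitrary: f)
  case empty
  interpret product_sigma_finite "\<lambda>_. lborel :: real measure" by (rule product_sigma_finite_lborel)
  show ?case by (simp add: PiM_empty nn_integral_count_space_finite restrict_def)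
next
  case (insert k I)
  interpret product_sigma_finite "\<lambda>_. lborel :: real measure" by (rule product_sigma_finite_lborel)
  note [measurable] = insert.prems(2)
  note fin = insert.hyps
  let ?T = "\<lambda>I x. \<lambda>i\<in>I. t i + c i * x i"
  have upd: "(\<lambda>z. (fst z)(k := t k + c k * snd z)) \<in>
      (\<Pi>\<^sub>M i \<in> I. lborel) \<Otimes>\<^sub>M lborel \<rightarrow>\<^sub>M (\<Pi>\<^sub>M i \<in> insert k I. lborel :: real measure)"
    by (rule measurable_fun_upd[where J=I]) auto
  have meas: "(\<lambda>x. \<integral>\<^sup>+y. f (x(k := t k + c k * y)) \<partial>lborel) \<in> borel_measurable (\<Pi>\<^sub>M i \<in> I. lborel)"
    using measurable_compose[OF upd insert.prems(2)]
    by (intro lborel.borel_measurable_nn_integral) (simp add: split_beta)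
  have upd1: "(\<lambda>y. f (x(k := y))) \<in> borel_measurable borel" if "x \<in> space (\<Pi>\<^sub>M i \<in> I. lborel)" for x
    using measurable_comp[OF measurable_component_update insert.prems(2), OF that \<open>k \<notin> I\<close>]
    by (simp add: comp_def fun_upd_def)
  have T[measurable]: "?T (insert k I) \<in> (\<Pi>\<^sub>M i \<in> insert k I. lborel) \<rightarrow>\<^sub>M (\<Pi>\<^sub>M i \<in> insert k I. lborel)"
    by (rule measurable_restrict) simp
  have "(\<integral>\<^sup>+x. f x \<partial>(\<Pi>\<^sub>M i \<in> insert k I. lborel)) =
      (\<integral>\<^sup>+x. \<integral>\<^sup>+y. f (x(k := y)) \<partial>lborel \<partial>(\<Pi>\<^sub>M i \<in> I. lborel))"
    using fin by (intro product_nn_integral_insert) simp_all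
  also have "\<dots> = (\<integral>\<^sup>+x. ennreal \<bar>c k\<bar> * (\<integral>\<^sup>+y. f (x(k := t k + c k * y)) \<partial>lborel) \<partial>(\<Pi>\<^sub>M i \<in> I. lborel))"
    by (intro nn_integral_cong nn_integral_real_affine upd1) (simp_all add: insert.prems)
  also have "\<dots> = ennreal \<bar>c k\<bar> * (\<integral>\<^sup>+x. \<integral>\<^sup>+y. f (x(k := t k + c k * y)) \<partial>lborel \<partial>(\<Pi>\<^sub>M i \<in> I. lborel))"
    by (rule nn_integral_cmult[OF meas])
  \<comment> \<open>The induction hypothesis is used for the function of \<open>x\<close> in which
    coordinate \<open>k\<close> has already been integrated out.\<close>
  also have "(\<integral>\<^sup>+x. \<integral>\<^sup>+y. f (x(k := t k + c k * y)) \<partial>lborel \<partial>(\<Pi>\<^sub>M i \<in> I. lborel)) =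
      ennreal (\<Prod>i\<in>I. \<bar>c i\<bar>) *
      (\<integral>\<^sup>+x. \<integral>\<^sup>+y. f ((?T I x)(k := t k + c k * y)) \<partial>lborel \<partial>(\<Pi>\<^sub>M i \<in> I. lborel))"
    by (rule insert.IH[OF _ meas]) (simp add: insert.prems)
  also have "(\<integral>\<^sup>+x. \<integral>\<^sup>+y. f ((?T I x)(k := t k + c k * y)) \<partial>lborel \<partial>(\<Pi>\<^sub>M i \<in> I. lborel)) =
      (\<integral>\<^sup>+x. \<integral>\<^sup>+y. f (?T (insert k I) (x(k := y))) \<partial>lborel \<partial>(\<Pi>\<^sub>M i \<in> I. lborel))"
  proof (intro nn_integral_cong arg_cong[of _ _ f])
    fix x y
    show "(?T I x)(k := t k + c k * y) = ?T (insert k I) (x(k := y))"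
      using fin by (auto simp: fun_eq_iff)
  qed
  also have "\<dots> = (\<integral>\<^sup>+x. f (?T (insert k I) x) \<partial>(\<Pi>\<^sub>M i \<in> insert k I. lborel))"
    using fin by (intro product_nn_integral_insert[symmetric]) simp_all
  also have "ennreal \<bar>c k\<bar> * (ennreal (\<Prod>i\<in>I. \<bar>c i\<bar>) * R) = ennreal (\<Prod>i\<in>insert k I. \<bar>c i\<bar>) * R" for R
    using fin by (simp add: ennreal_mult prod_nonneg mult.assoc)
  finally show ?case .
qed

text \<open>By \<open>cong\<close> the shift of the coordinates in \<open>J\<close> is determined by
  those in \<open>I\<close>. Once the latter are fixed, the map is a translation, hence has Jacobian
  1. Measurability of the map is concluded as well so that two such maps can be composed.\<close>

lemma nn_integral_PiM_block_shear:
  fixes g :: "'i \<Rightarrow> ('i \<Rightarrow> real) \<Rightarrow> real"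
  assumes IJ: "I \<inter> J = {}" "finite I" "finite J" "I \<union> J = K"
    and f[measurable]: "f \<in> borel_measurable (\<Pi>\<^sub>M i \<in> K. lborel)"
    and g[measurable]: "\<And>i. i \<in> J \<Longrightarrow> g i \<in> borel_measurable (\<Pi>\<^sub>M i \<in> K. lborel)"
    and cong: "\<And>i z z'. i \<in> J \<Longrightarrow> (\<And>l. l \<in> I \<Longrightarrow> z l = z' l) \<Longrightarrow> g i z = g i z'"
  shows "(\<lambda>z. \<lambda>i\<in>K. if i \<in> J then g i z + z i else z i) \<in>
      (\<Pi>\<^sub>M i \<in> K. lborel) \<rightarrow>\<^sub>M (\<Pi>\<^sub>M i \<in> K. lborel)" (is "?T \<in> _")
    and "(\<integral>\<^sup>+z. f z \<partial>(\<Pi>\<^sub>M i \<in> K. lborel)) =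
      (\<integral>\<^sup>+z. f (\<lambda>i\<in>K. if i \<in> J then g i z + z i else z i) \<partial>(\<Pi>\<^sub>M i \<in> K. lborel))"
proof -
  interpret product_sigma_finite "\<lambda>_. lborel :: real measure" by (rule product_sigma_finite_lborel)
  show T[measurable]: "?T \<in> (\<Pi>\<^sub>M i \<in> K. lborel) \<rightarrow>\<^sub>M (\<Pi>\<^sub>M i \<in> K. lborel)"
  proof (rule measurable_restrict)
    fix i assume [simp]: "i \<in> K"
    show "(\<lambda>z. if i \<in> J then g i z + z i else z i) \<in> (\<Pi>\<^sub>M i \<in> K. lborel) \<rightarrow>\<^sub>M lborel"
      using g[of i] by (cases "i \<in> J") simp_all
  qed
  have "(\<integral>\<^sup>+z. f z \<partial>(\<Pi>\<^sub>M i \<in> K. lborel)) =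
      (\<integral>\<^sup>+x. \<integral>\<^sup>+y. f (merge I J (x, y)) \<partial>(\<Pi>\<^sub>M i \<in> J. lborel) \<partial>(\<Pi>\<^sub>M i \<in> I. lborel))"
    unfolding IJ(4)[symmetric] using IJ f by (intro product_nn_integral_fold) simp_all
  also have "\<dots> = (\<integral>\<^sup>+x. \<integral>\<^sup>+y. f (?T (merge I J (x, y))) \<partial>(\<Pi>\<^sub>M i \<in> J. lborel) \<partial>(\<Pi>\<^sub>M i \<in> I. lborel))"
  proof (rule nn_integral_cong)
    fix x :: "'i \<Rightarrow> real" assume x: "x \<in> space (\<Pi>\<^sub>M i \<in> I. lborel)"
    have fm: "(\<lambda>y. f (merge I J (x, y))) \<in> borel_measurable (\<Pi>\<^sub>M i \<in> J. lborel)"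
      using measurable_comp[OF measurable_Pair1'[OF x, of "\<Pi>\<^sub>M i \<in> J. lborel"]
          measurable_comp[OF measurable_merge f[folded IJ(4)]]]
      by (simp add: comp_def)
    have "(\<integral>\<^sup>+y. f (merge I J (x, y)) \<partial>(\<Pi>\<^sub>M i \<in> J. lborel)) =
       (\<integral>\<^sup>+y. f (merge I J (x, \<lambda>i\<in>J. g i x + 1 * y i)) \<partial>(\<Pi>\<^sub>M i \<in> J. lborel))"
      using nn_integral_PiM_affine[OF IJ(3) _ fm, of "\<lambda>_. 1" "\<lambda>i. g i x"] by simp
    also have "\<dots> = (\<integral>\<^sup>+y. f (?T (merge I J (x, y))) \<partial>(\<Pi>\<^sub>M i \<in> J. lborel))"
    proof (intro nn_integral_cong arg_cong[of _ _ f])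
      fix y :: "'i \<Rightarrow> real"
      \<comment> \<open>The merged point agrees with \<open>x\<close> on \<open>I\<close>, so the
        shift does not depend on \<open>y\<close>.\<close>
      have "g i (merge I J (x, y)) = g i x" if "i \<in> J" for i
        using that by (rule cong) (simp add: merge_def)
      then show "merge I J (x, \<lambda>i\<in>J. g i x + 1 * y i) = ?T (merge I J (x, y))"
        using IJ by (auto simp: merge_def fun_eq_iff)
    qed
    finally show "(\<integral>\<^sup>+y. f (merge I J (x, y)) \<partial>(\<Pi>\<^sub>M i \<in> J. lborel)) =
       (\<integral>\<^sup>+y. f (?T (merge I J (x, y))) \<partial>(\<Pi>\<^sub>M i \<in> J. lborel))" .
  qed
  also have "\<dots> = (\<integral>\<^sup>+z. f (?T z) \<partial>(\<Pi>\<^sub>M i \<in> K. lborel))"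
  proof -
    have "(\<lambda>z. f (?T z)) \<in> borel_measurable (\<Pi>\<^sub>M i \<in> K. lborel)" by measurable
    then show ?thesis
      unfolding IJ(4)[symmetric] using IJ by (intro product_nn_integral_fold[symmetric]) simp_all
  qed
  finally show "(\<integral>\<^sup>+z. f z \<partial>(\<Pi>\<^sub>M i \<in> K. lborel)) = (\<integral>\<^sup>+z. f (?T z) \<partial>(\<Pi>\<^sub>M i \<in> K. lborel))" .
qed

section \<open>Translations and congruences in the space of symmetric matrices\<close>

lemma nn_integral_sym_lborel_translate:
  fixes Q :: "real^'p^'p"
  assumes [measurable]: "f \<in> borel_measurable borel" and "transpose Q = Q"
  shows "(\<integral>\<^sup>+X. f X \<partial>sym_lborel) = (\<integral>\<^sup>+X. f (Q + X) \<partial>sym_lborel)"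
proof -
  have Q: "Q $ i $ j = Q $ j $ i" for i j
    by (rule symmetric_nth[OF assms(2)])
  have "(\<integral>\<^sup>+X. f X \<partial>sym_lborel) = (\<integral>\<^sup>+x. f (sym_matrix x) \<partial>edge_measure UNIV)"
    by (intro nn_integral_sym_lborel) measurable
  also have "\<dots> = (\<integral>\<^sup>+x. f (sym_matrix (\<lambda>e\<in>edges UNIV. entry Q e + 1 * x e)) \<partial>edge_measure UNIV)"
    using nn_integral_PiM_affine[of "edges UNIV" "\<lambda>_. 1" "\<lambda>x. f (sym_matrix x)" "entry Q"] by simp
  also have "\<dots> = (\<integral>\<^sup>+x. f (Q + sym_matrix x) \<partial>edge_measure UNIV)"
    by (intro nn_integral_cong arg_cong[of _ _ f]) (simp add: vec_eq_iff entry_doubleton[OF Q])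
  also have "\<dots> = (\<integral>\<^sup>+X. f (Q + X) \<partial>sym_lborel)"
    by (intro nn_integral_sym_lborel[symmetric]) measurable
  finally show ?thesis .
qed

text \<open>In edge coordinates the congruence is diagonal: the loop at \<open>k\<close> is scaled
  by the square of \<open>r\<close>, the p - 1 other edges at \<open>k\<close> by \<open>r\<close>,
  and the rest by 1. The Jacobian exponent is therefore 2 + (p - 1).\<close>

lemma nn_integral_sym_lborel_stretch:
  fixes f :: "real^'p^'p \<Rightarrow> ennreal"
  assumes [measurable]: "f \<in> borel_measurable borel" and "r \<noteq> 0"
  shows "(\<integral>\<^sup>+X. f X \<partial>sym_lborel) = ennreal (\<bar>r\<bar> ^ (CARD('p) + 1)) *
    (\<integral>\<^sup>+X. f (stretch k r ** X ** transpose (stretch k r)) \<partial>sym_lborel)"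
proof -
  define c where "c e = (if e = {k} then r\<^sup>2 else if k \<in> e then r else 1)" for e
  let ?J = "UNIV - {k}"
  have "(\<Prod>e\<in>edges UNIV. \<bar>c e\<bar>) =
      (\<Prod>e\<in>insert {k} ((\<lambda>j. {k, j}) ` ?J). \<bar>c e\<bar>) * (\<Prod>e\<in>edges ?J. \<bar>c e\<bar>)"
    unfolding edges_UNIV[of k] by (intro prod.union_disjoint edges_star_disjoint) simp_all
  also have "(\<Prod>e\<in>edges ?J. \<bar>c e\<bar>) = 1"
    by (rule prod.neutral) (auto simp: c_def edges_def)
  also have "(\<Prod>e\<in>insert {k} ((\<lambda>j. {k, j}) ` ?J). \<bar>c e\<bar>) = \<bar>r\<bar>\<^sup>2 * (\<Prod>e\<in>(\<lambda>j. {k, j}) ` ?J. \<bar>c e\<bar>)"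
    by (subst prod.insert) (auto simp: c_def doubleton_eq_iff)
  also have "(\<Prod>e\<in>(\<lambda>j. {k, j}) ` ?J. \<bar>c e\<bar>) = (\<Prod>j\<in>?J. \<bar>r\<bar>)"
    by (subst prod.reindex[OF inj_on_star]) (auto simp: c_def intro!: prod.cong)
  also have "\<bar>r\<bar>\<^sup>2 * \<dots> * 1 = \<bar>r\<bar> ^ (2 + (CARD('p) - 1))"
    by (simp only: power_add mult_1_right prod_constant card_Diff_singleton UNIV_I)
  \<comment> \<open>The subtraction is in the natural numbers, so positivity of the dimension
    enters.\<close>
  also have "2 + (CARD('p) - 1) = CARD('p) + 1"
    using zero_less_card_finite[where 'a='p] by simp
  finally have prod: "(\<Prod>e\<in>edges UNIV. \<bar>c e\<bar>) = \<bar>r\<bar> ^ (CARD('p) + 1)" .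
  have "(\<integral>\<^sup>+X. f X \<partial>sym_lborel) = (\<integral>\<^sup>+x. f (sym_matrix x) \<partial>edge_measure UNIV)"
    by (intro nn_integral_sym_lborel) measurable
  also have "\<dots> = ennreal (\<Prod>e\<in>edges UNIV. \<bar>c e\<bar>) *
      (\<integral>\<^sup>+x. f (sym_matrix (\<lambda>e\<in>edges UNIV. 0 + c e * x e)) \<partial>edge_measure UNIV)"
    using \<open>r \<noteq> 0\<close> by (intro nn_integral_PiM_affine[where t="\<lambda>_. 0"]) (simp_all add: c_def)
  also have "(\<integral>\<^sup>+x. f (sym_matrix (\<lambda>e\<in>edges UNIV. 0 + c e * x e)) \<partial>edge_measure UNIV) =
     (\<integral>\<^sup>+x. f (stretch k r ** sym_matrix x ** transpose (stretch k r)) \<partial>edge_measure UNIV)"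
    by (intro nn_integral_cong arg_cong[of _ _ f])
       (auto simp: vec_eq_iff stretch_congruence c_def power2_eq_square doubleton_eq_iff)
  also have "\<dots> = (\<integral>\<^sup>+X. f (stretch k r ** X ** transpose (stretch k r)) \<partial>sym_lborel)"
    by (intro nn_integral_sym_lborel[symmetric]) measurable
  finally show ?thesis by (simp only: prod)
qed

text \<open>The congruence is a composition of two block shears of Jacobian 1. \<open>?T1\<close>
  shifts the entries away from row and column \<open>k\<close> by amounts depending on the star of
  \<open>k\<close>; then \<open>?T2\<close> shifts the off-diagonal entries of the star by multiples
  of the pivot, which never changes.\<close>

lemma nn_integral_sym_lborel_shear:
  fixes f :: "real^'p^'p \<Rightarrow> ennreal"
  assumes [measurable]: "f \<in> borel_measurable borel" and u: "u $ k = 0"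
  shows "(\<integral>\<^sup>+X. f X \<partial>sym_lborel) =
    (\<integral>\<^sup>+X. f (shear k u ** X ** transpose (shear k u)) \<partial>sym_lborel)"
proof -
  let ?E = "edges (UNIV :: 'p set)" and ?R = "edges (UNIV - {k})"
  let ?B = "(\<lambda>j. {k, j}) ` (UNIV - {k})"
  \<comment> \<open>\<open>Q1\<close> and \<open>Q2\<close> are the two increments, read off from
    \<open>shear_congruence\<close>. They are symmetric matrices for every \<open>z\<close>, as
    \<open>entry\<close> requires.\<close>
  define Q1 where "Q1 z = (\<chi> i j. u $ i * z {k, j} + u $ j * z {i, k} + u $ i * u $ j * z {k})"
    for z :: "'p set \<Rightarrow> real"
  define Q2 where "Q2 z = (\<chi> i j. (if i = k then u $ j else 0) * z {k} + (if j = k then u $ i else 0) * z {k})"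
    for z :: "'p set \<Rightarrow> real"
  have Q1: "entry (Q1 z) {i, j} = u $ i * z {k, j} + u $ j * z {i, k} + u $ i * u $ j * z {k}" for z i j
    by (subst entry_doubleton) (simp_all add: Q1_def insert_commute)
  have Q2: "entry (Q2 z) {i, j} = (if i = k then u $ j else 0) * z {k} + (if j = k then u $ i else 0) * z {k}" for z i j
    by (subst entry_doubleton) (simp_all add: Q2_def)
  let ?T1 = "\<lambda>z. \<lambda>e\<in>?E. if e \<in> ?R then entry (Q1 z) e + z e else z e"
  let ?T2 = "\<lambda>z. \<lambda>e\<in>?E. if e \<in> ?B then entry (Q2 z) e + z e else z e"
  have f1: "(\<lambda>z. f (sym_matrix z)) \<in> borel_measurable (edge_measure UNIV)" by measurable
  have dis: "insert {k} ?B \<inter> ?R = {}" by (rule edges_star_disjoint) simp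
  have meas: "(\<lambda>z. entry (Q z) e) \<in> borel_measurable (edge_measure UNIV)"
    if Q: "Q = Q1 \<or> Q = Q2" and e: "e \<in> ?E" for Q e
  proof -
    obtain i j where "e = {i, j}" using e by (auto simp: edges_def)
    then show ?thesis using Q by (auto simp: Q1 Q2)
  qed
  have sub: "?B \<subseteq> ?E" "?R \<subseteq> ?E" by (auto simp: edges_def)
  have IJ2: "insert {k} ?R \<inter> ?B = {}" "finite (insert {k} ?R)" "finite ?B" "insert {k} ?R \<union> ?B = ?E"
    using dis edges_UNIV[of k] by (auto simp: doubleton_eq_iff)
  have IJ1: "insert {k} ?B \<inter> ?R = {}" "finite (insert {k} ?B)" "finite ?R" "insert {k} ?B \<union> ?R = ?E"
    using dis edges_UNIV[of k] by simp_all
  have c2: "entry (Q2 z) e = entry (Q2 z') e" if "e \<in> ?B" "\<And>l. l \<in> insert {k} ?R \<Longrightarrow> z l = z' l" for e z z'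
  proof -
    have "Q2 z = Q2 z'" using that(2)[of "{k}"] by (simp add: Q2_def)
    then show ?thesis by simp
  qed
  have c1: "entry (Q1 z) e = entry (Q1 z') e" if "e \<in> ?R" "\<And>l. l \<in> insert {k} ?B \<Longrightarrow> z l = z' l" for e z z'
  proof -
    have "z {k, j} = z' {k, j}" for j using that(2)[of "{k, j}"] that(2)[of "{k}"]
      by (cases "j = k") auto
    moreover from this have "z {i, k} = z' {i, k}" for i by (simp add: insert_commute[of i k])
    ultimately have "Q1 z = Q1 z'" using that(2)[of "{k}"] by (simp add: Q1_def)
    then show ?thesis by simp
  qed
  have m1: "(\<lambda>z. entry (Q1 z) e) \<in> borel_measurable (edge_measure UNIV)" if "e \<in> ?R" for e
    using that sub by (intro meas) auto
  have m2: "(\<lambda>z. entry (Q2 z) e) \<in> borel_measurable (edge_measure UNIV)" if "e \<in> ?B" for e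
    using that sub by (intro meas) auto
  note shear1 = nn_integral_PiM_block_shear[where g="\<lambda>e z. entry (Q1 z) e", OF IJ1 _ m1 c1]
  note shear2 = nn_integral_PiM_block_shear[where g="\<lambda>e z. entry (Q2 z) e", OF IJ2 _ m2 c2]
  have T2: "?T2 \<in> edge_measure UNIV \<rightarrow>\<^sub>M edge_measure UNIV"
    by (rule shear2(1)[OF f1])
  have f2: "(\<lambda>z. f (sym_matrix (?T2 z))) \<in> borel_measurable (edge_measure UNIV)"
    using measurable_comp[OF T2 f1] by (simp add: comp_def)
  have "(\<integral>\<^sup>+X. f X \<partial>sym_lborel) = (\<integral>\<^sup>+z. f (sym_matrix z) \<partial>edge_measure UNIV)"
    by (intro nn_integral_sym_lborel) measurable
  \<comment> \<open>\<open>?T2\<close> is introduced first and \<open>?T1\<close> is then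
    substituted inside it. Hence \<open>?T1\<close> acts first on a point and still sees the old
    star entries.\<close>
  also have "\<dots> = (\<integral>\<^sup>+z. f (sym_matrix (?T2 z)) \<partial>edge_measure UNIV)"
    by (rule shear2(2)[OF f1])
  also have "\<dots> = (\<integral>\<^sup>+z. f (sym_matrix (?T2 (?T1 z))) \<partial>edge_measure UNIV)"
    by (rule shear1(2)[OF f2])
  also have "\<dots> = (\<integral>\<^sup>+z. f (shear k u ** sym_matrix z ** transpose (shear k u)) \<partial>edge_measure UNIV)"
  proof (intro nn_integral_cong arg_cong[of _ _ f])
    fix z :: "'p set \<Rightarrow> real"
    have B: "{i, j} \<in> ?B \<longleftrightarrow> (i = k \<and> j \<noteq> k) \<or> (i \<noteq> k \<and> j = k)" for i j
      unfolding image_iff doubleton_eq_iff by blast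
    have T1: "?T1 z {i, j} = (if i = k \<or> j = k then z {i, j}
        else u $ i * z {k, j} + u $ j * z {i, k} + u $ i * u $ j * z {k} + z {i, j})" for i j
      by (simp add: Q1)
    have T1k: "?T1 z {k} = z {k}" using T1[of k k] by simp
    have T2: "?T2 w {i, j} = (if i = k \<and> j \<noteq> k then u $ j * w {k} + w {i, j}
        else if i \<noteq> k \<and> j = k then u $ i * w {k} + w {i, j} else w {i, j})" for w i j
      unfolding restrict_apply B by (simp add: Q2)
    show "sym_matrix (?T2 (?T1 z)) = shear k u ** sym_matrix z ** transpose (shear k u)"
      unfolding vec_eq_iff
    proof (intro allI)
      fix i j
      show "sym_matrix (?T2 (?T1 z)) $ i $ j = (shear k u ** sym_matrix z ** transpose (shear k u)) $ i $ j"
        unfolding shear_congruence sym_matrix_nth T2 T1 T1k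
        by (cases "i = k"; cases "j = k") (simp_all add: u)
    qed
  qed
  also have "\<dots> = (\<integral>\<^sup>+X. f (shear k u ** X ** transpose (shear k u)) \<partial>sym_lborel)"
    by (intro nn_integral_sym_lborel[symmetric]) measurable
  finally show ?thesis .
qed

text \<open>Induction over the generators with \<open>f\<close> arbitrary: the hypothesis for
  \<open>L\<close> is applied to \<open>f\<close> composed with the outermost congruence. Jacobians
  multiply just as determinants do.\<close>

lemma nn_integral_sym_lborel_congruence:
  fixes L :: "real^'p^'p"
  assumes "L \<in> elementary_products" "f \<in> borel_measurable borel"
  shows "(\<integral>\<^sup>+X. f X \<partial>sym_lborel) = ennreal (\<bar>det L\<bar> ^ (CARD('p) + 1)) *
    (\<integral>\<^sup>+X. f (L ** X ** transpose L) \<partial>sym_lborel)"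
  using assms
proof (induction arbitrary: f)
  case one
  then show ?case by (simp add: transpose_mat)
next
  case (shear u k L)
  have "(\<lambda>X. f (shear k u ** X ** transpose (shear k u))) \<in> borel_measurable borel"
    using shear.prems by measurable
  then show ?case
    using shear.IH shear.hyps(1) nn_integral_sym_lborel_shear[OF shear.prems shear.hyps(1)]
    by (simp add: det_mul det_shear matrix_transpose_mul matrix_mul_assoc)
next
  case (stretch r L k)
  have "(\<lambda>X. f (stretch k r ** X ** transpose (stretch k r))) \<in> borel_measurable borel"
    using stretch.prems by measurable
  then show ?case
    using stretch.IH stretch.hyps(1) nn_integral_sym_lborel_stretch[OF stretch.prems stretch.hyps(1), of k]
    by (simp add: det_mul det_stretch matrix_transpose_mul matrix_mul_assoc abs_mult
        power_mult_distrib ennreal_mult mult.assoc mult.left_commute)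
qed

section \<open>The multivariate Gamma integral\<close>

text \<open>The integrand of the multivariate Gamma integral for the block over \<open>J\<close>.
  The trace runs over \<open>J\<close> alone, since the identity padding would add a
  constant.\<close>

definition gamma_kernel :: "'p set \<Rightarrow> real \<Rightarrow> real^'p^'p \<Rightarrow> real" where
  "gamma_kernel J a X =
     (if pos_def (principal_block J X)
      then det (principal_block J X) powr (a - (real (card J) + 1) / 2) * exp (- (\<Sum>i\<in>J. X $ i $ i))
      else 0)"

lemma gamma_kernel_nonneg [simp]: "0 \<le> gamma_kernel J a X"
  by (simp add: gamma_kernel_def)

lemma gamma_kernel_cong:
  assumes "\<And>i j. i \<in> J \<Longrightarrow> j \<in> J \<Longrightarrow> X $ i $ j = Y $ i $ j"
  shows "gamma_kernel J a X = gamma_kernel J a Y"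
proof -
  have "principal_block J X = principal_block J Y"
    using assms by (simp add: principal_block_def vec_eq_iff)
  then show ?thesis using assms by (simp add: gamma_kernel_def)
qed

lemma measurable_gamma_kernel [measurable]:
  "(\<lambda>x. gamma_kernel J a (sym_matrix x)) \<in> borel_measurable (edge_measure (J :: 'p::finite set))"
proof -
  have [measurable]: "(\<lambda>x. principal_block J (sym_matrix x)) \<in> borel_measurable (edge_measure J)"
  proof (rule borel_measurable_matrixI)
    fix i j
    show "(\<lambda>x. principal_block J (sym_matrix x) $ i $ j) \<in> borel_measurable (edge_measure J)"
      by (cases "i \<in> J \<and> j \<in> J") (auto simp: principal_block_def)
  qed
  have [measurable]: "(\<lambda>x. \<Sum>i\<in>J. x {i}) \<in> borel_measurable (edge_measure J)"
    by (intro borel_measurable_sum) simp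
  show ?thesis
    unfolding gamma_kernel_def sym_matrix_nth by measurable
qed

text \<open>With pivot s, the determinant is s times that of the Schur complement, and the trace is
  s plus the squares of the pivot row over s plus the trace of the Schur complement. Lowering
  \<open>a\<close> by 1/2 compensates for the change of block size in the exponent.\<close>

lemma gamma_kernel_insert:
  fixes X :: "real^'p^'p"
  assumes "transpose X = X" "k \<notin> J"
  shows "gamma_kernel (insert k J) a X =
    (if 0 < X $ k $ k
     then X $ k $ k powr (a - (real (card J) + 2) / 2) * exp (- X $ k $ k) *
       (\<Prod>j\<in>J. exp (- ((X $ k $ j)\<^sup>2 / X $ k $ k))) * gamma_kernel J (a - 1 / 2) (schur k X)
     else 0)"
proof -
  have sym: "X $ i $ k = X $ k $ i" for i
    by (rule symmetric_nth[OF assms(1)])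
  let ?s = "X $ k $ k"
  have pos: "pos_def (principal_block (insert k J) X) \<longleftrightarrow> 0 < ?s \<and> pos_def (principal_block J (schur k X))"
    by (rule pos_def_principal_block_insert[OF assms])
  show ?thesis
  proof (cases "0 < ?s \<and> pos_def (principal_block J (schur k X))")
    case True
    have tr: "(\<Sum>i\<in>J. X $ i $ i) = (\<Sum>i\<in>J. (X $ k $ i)\<^sup>2 / ?s) + (\<Sum>i\<in>J. schur k X $ i $ i)"
      unfolding sum.distrib[symmetric]
    proof (rule sum.cong)
      fix i
      show "X $ i $ i = (X $ k $ i)\<^sup>2 / ?s + schur k X $ i $ i"
        using sym[of i] by (simp add: schur_def power2_eq_square)
    qed simp
    have e: "exp (- (\<Sum>i\<in>insert k J. X $ i $ i)) =
        exp (- ?s) * (\<Prod>j\<in>J. exp (- ((X $ k $ j)\<^sup>2 / ?s))) * exp (- (\<Sum>i\<in>J. schur k X $ i $ i))"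
      using assms(2) by (simp add: tr exp_sum[symmetric] exp_add[symmetric] sum_negf)
    have d: "det (principal_block (insert k J) X) powr c = ?s powr c * det (principal_block J (schur k X)) powr c" for c
      using True assms det_pos_def_pos[of "principal_block J (schur k X)"]
      by (simp add: det_principal_block_insert powr_mult)
    have c: "a - (real (card (insert k J)) + 1) / 2 = a - (real (card J) + 2) / 2"
        "a - 1 / 2 - (real (card J) + 1) / 2 = a - (real (card J) + 2) / 2"
      using assms(2) by (simp_all add: field_simps)
    show ?thesis
      using True by (simp add: gamma_kernel_def pos d e c)
  next
    case False
    then show ?thesis by (auto simp: gamma_kernel_def pos)
  qed
qed

lemma nn_integral_gaussian:
  assumes "0 < s"
  shows "(\<integral>\<^sup>+x. ennreal (exp (- (x\<^sup>2 / s))) \<partial>lborel) = ennreal (sqrt (pi * s))"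
proof -
  \<comment> \<open>A centred normal density of variance s/2 has exponent - x^2 / s.\<close>
  let ?\<sigma> = "sqrt (s / 2)"
  have n: "normal_density 0 ?\<sigma> x = 1 / sqrt (pi * s) * exp (- (x\<^sup>2 / s))" for x
    using assms by (simp add: normal_density_def)
  have "(\<integral>\<^sup>+x. ennreal (exp (- (x\<^sup>2 / s))) \<partial>lborel) =
      (\<integral>\<^sup>+x. ennreal (sqrt (pi * s)) * ennreal (normal_density 0 ?\<sigma> x) \<partial>lborel)"
    using assms by (intro nn_integral_cong) (simp add: n ennreal_mult[symmetric])
  also have "\<dots> = ennreal (sqrt (pi * s)) * (\<integral>\<^sup>+x. ennreal (normal_density 0 ?\<sigma> x) \<partial>lborel)"
    by (rule nn_integral_cmult) simp
  also have "(\<integral>\<^sup>+x. ennreal (normal_density 0 ?\<sigma> x) \<partial>lborel) = 1"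
    using assms by (subst nn_integral_eq_integral) (simp_all del: real_sqrt_divide)
  finally show ?thesis by simp
qed

lemma multivariate_Gamma_0 [simp]: "multivariate_Gamma 0 a = 1"
  by (simp add: multivariate_Gamma_def)

text \<open>The factor for \<open>j = 1\<close> is split off and the others are reindexed, which
  lowers the argument by 1/2. The powers of pi match because (n + 1) n / 4 = n / 2 + n (n - 1) /
  4.\<close>

lemma multivariate_Gamma_Suc:
  "multivariate_Gamma (Suc n) a = pi powr (real n / 2) * Gamma a * multivariate_Gamma n (a - 1 / 2)"
proof -
  have "(\<Prod>j=1..Suc n. Gamma (a - (real j - 1) / 2)) =
      Gamma a * (\<Prod>j=Suc 1..Suc n. Gamma (a - (real j - 1) / 2))"
    by (subst prod.atLeast_Suc_atMost) simp_all
  also have "(\<Prod>j=Suc 1..Suc n. Gamma (a - (real j - 1) / 2)) =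
      (\<Prod>j=1..n. Gamma (a - 1 / 2 - (real j - 1) / 2))"
    unfolding prod.shift_bounds_cl_Suc_ivl by (intro prod.cong) (simp_all add: field_simps)
  finally show ?thesis
    by (simp add: multivariate_Gamma_def powr_add[symmetric] field_simps)
qed

lemma multivariate_Gamma_pos:
  assumes "(real n - 1) / 2 < a"
  shows "0 < multivariate_Gamma n a"
proof -
  have "0 < (\<Prod>j=1..n. Gamma (a - (real j - 1) / 2))"
    using assms by (intro prod_pos Gamma_real_pos) (auto simp: field_simps)
  then show ?thesis by (simp add: multivariate_Gamma_def)
qed

text \<open>For fixed star coordinates \<open>x\<close>, passing to the Schur complement merely
  translates the block coordinates \<open>y\<close>, by a vector \<open>t\<close> that does not
  depend on \<open>y\<close>. The factor 1 gives it the shape of the affine substitution.\<close>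

lemma gamma_kernel_schur_merge:
  fixes J :: "'p::finite set"
  assumes "K \<inter> edges J = {}" "{k} \<in> K" "\<And>j. j \<in> J \<Longrightarrow> {k, j} \<in> K"
  shows "\<exists>t. \<forall>y. gamma_kernel J a (schur k (sym_matrix (merge K (edges J) (x, y)))) =
    gamma_kernel J a (sym_matrix (\<lambda>e\<in>edges J. t e + 1 * y e))"
proof (intro exI allI gamma_kernel_cong)
  define Q where "Q = (\<chi> i j. - (x {i, k} * x {k, j} / x {k}))"
  have Q: "entry Q {i, j} = - (x {i, k} * x {k, j} / x {k})" for i j
    by (subst entry_doubleton) (simp_all add: Q_def insert_commute)
  fix y i j assume ij: "i \<in> J" "j \<in> J"
  have "{i, j} \<notin> K" "{k, i} \<in> K" "{k, j} \<in> K"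
    using ij assms by auto
  then show "schur k (sym_matrix (merge K (edges J) (x, y))) $ i $ j =
      sym_matrix (\<lambda>e\<in>edges J. entry Q e + 1 * y e) $ i $ j"
    using ij assms(2) by (simp add: Q schur_def merge_def insert_commute[of _ k])
qed

text \<open>Induction over \<open>J\<close>, integrating in three stages: the Schur complement gives
  the smaller Gamma value at \<open>a - 1 / 2\<close>, each entry of the pivot row gives a Gaussian
  factor sqrt(pi s), and the pivot s gives a one-dimensional Gamma integral.\<close>

lemma nn_integral_gamma_kernel:
  fixes J :: "'p::finite set"
  assumes "(real (card J) - 1) / 2 < a"
  shows "(\<integral>\<^sup>+x. gamma_kernel J a (sym_matrix x) \<partial>edge_measure J) = multivariate_Gamma (card J) a"
proof -
  have "finite J" by simp
  then show ?thesis using assms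
  proof (induction J arbitrary: a)
    case empty
    have "principal_block {} X = mat 1" for X :: "real^'p^'p"
      by (simp add: principal_block_def mat_def)
    moreover have "pos_def (mat 1 :: real^'p^'p)"
      by (simp add: pos_def_def transpose_mat)
    ultimately show ?case
      by (simp add: gamma_kernel_def PiM_empty nn_integral_count_space_finite)
  next
    case (insert k J)
    interpret product_sigma_finite "\<lambda>_. lborel :: real measure" by (rule product_sigma_finite_lborel)
    let ?B = "(\<lambda>j. {k, j}) ` J"
    let ?K = "insert {k} ?B"
    let ?n = "card J"
    let ?G = "multivariate_Gamma ?n (a - 1 / 2)"
    have a: "real ?n / 2 < a" using insert by simp
    have kB: "{k} \<notin> ?B" using insert by (auto simp: doubleton_eq_iff)
    \<comment> \<open>\<open>C\<close> collects the factors of the kernel that depend on the star of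
      \<open>k\<close> only.\<close>
    define C where "C x = (if 0 < x {k}
        then x {k} powr (a - (real ?n + 2) / 2) * exp (- x {k}) * (\<Prod>j\<in>J. exp (- ((x {k, j})\<^sup>2 / x {k})))
        else 0)" for x :: "'p set \<Rightarrow> real"
    have C_nonneg: "0 \<le> C x" for x by (simp add: C_def prod_nonneg)
    have [measurable]: "C \<in> borel_measurable (\<Pi>\<^sub>M e \<in> ?K. lborel)"
    proof -
      have [measurable]: "(\<lambda>x :: 'p set \<Rightarrow> real. x {k}) \<in> borel_measurable (\<Pi>\<^sub>M e \<in> ?K. lborel)" by simp
      have [measurable]: "(\<lambda>x :: 'p set \<Rightarrow> real. \<Prod>j\<in>J. exp (- ((x {k, j})\<^sup>2 / x {k}))) \<in> borel_measurable (\<Pi>\<^sub>M e \<in> ?K. lborel)"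
      proof (rule borel_measurable_prod)
        fix j assume "j \<in> J"
        then have "{k, j} \<in> ?K" by blast
        then have "(\<lambda>x. x {k, j}) \<in> (\<Pi>\<^sub>M e \<in> ?K. lborel :: real measure) \<rightarrow>\<^sub>M lborel"
          by (rule measurable_component_singleton)
        then have [measurable]: "(\<lambda>x. x {k, j}) \<in> borel_measurable (\<Pi>\<^sub>M e \<in> ?K. lborel :: real measure)"
          by simp
        show "(\<lambda>x :: 'p set \<Rightarrow> real. exp (- ((x {k, j})\<^sup>2 / x {k}))) \<in> borel_measurable (\<Pi>\<^sub>M e \<in> ?K. lborel)"
          by measurable
      qed
      show ?thesis unfolding C_def by measurable
    qed
    have "(\<integral>\<^sup>+x. gamma_kernel (insert k J) a (sym_matrix x) \<partial>edge_measure (insert k J)) =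
      (\<integral>\<^sup>+x. \<integral>\<^sup>+y. gamma_kernel (insert k J) a (sym_matrix (merge ?K (edges J) (x, y)))
        \<partial>edge_measure J \<partial>(\<Pi>\<^sub>M e \<in> ?K. lborel))"
      using measurable_gamma_kernel[of "insert k J" a] unfolding edges_insert
      by (intro product_nn_integral_fold edges_star_disjoint insert.hyps) simp_all
    also have "\<dots> = (\<integral>\<^sup>+x. ennreal (C x) * ennreal ?G \<partial>(\<Pi>\<^sub>M e \<in> ?K. lborel))"
    proof (rule nn_integral_cong)
      fix x :: "'p set \<Rightarrow> real"
      obtain t where t: "\<And>y. gamma_kernel J (a - 1 / 2) (schur k (sym_matrix (merge ?K (edges J) (x, y)))) =
          gamma_kernel J (a - 1 / 2) (sym_matrix (\<lambda>e\<in>edges J. t e + 1 * y e))"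
        using gamma_kernel_schur_merge[OF edges_star_disjoint[OF insert.hyps(2)]] by blast
      have T: "(\<lambda>y. \<lambda>e\<in>edges J. t e + 1 * y e) \<in> edge_measure J \<rightarrow>\<^sub>M edge_measure J"
        by (rule measurable_restrict) simp
      have "(\<integral>\<^sup>+y. gamma_kernel (insert k J) a (sym_matrix (merge ?K (edges J) (x, y))) \<partial>edge_measure J) =
        (\<integral>\<^sup>+y. ennreal (C x) * gamma_kernel J (a - 1 / 2) (sym_matrix (\<lambda>e\<in>edges J. t e + 1 * y e))
          \<partial>edge_measure J)"
      proof (rule nn_integral_cong)
        fix y :: "'p set \<Rightarrow> real"
        have "merge ?K (edges J) (x, y) {k} = x {k}" "\<And>j. j \<in> J \<Longrightarrow> merge ?K (edges J) (x, y) {k, j} = x {k, j}"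
          by (simp_all add: merge_def)
        then have "gamma_kernel (insert k J) a (sym_matrix (merge ?K (edges J) (x, y))) =
            C x * gamma_kernel J (a - 1 / 2) (schur k (sym_matrix (merge ?K (edges J) (x, y))))"
          using insert.hyps by (simp add: gamma_kernel_insert C_def)
        then show "ennreal (gamma_kernel (insert k J) a (sym_matrix (merge ?K (edges J) (x, y)))) =
            ennreal (C x) * ennreal (gamma_kernel J (a - 1 / 2) (sym_matrix (\<lambda>e\<in>edges J. t e + 1 * y e)))"
          by (simp only: t ennreal_mult[OF C_nonneg gamma_kernel_nonneg])
      qed
      also have "\<dots> = ennreal (C x) *
          (\<integral>\<^sup>+y. gamma_kernel J (a - 1 / 2) (sym_matrix (\<lambda>e\<in>edges J. t e + 1 * y e)) \<partial>edge_measure J)"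
        using measurable_comp[OF T measurable_gamma_kernel] by (intro nn_integral_cmult) (simp add: comp_def)
      \<comment> \<open>Translation invariance removes \<open>t\<close>.\<close>
      also have "(\<integral>\<^sup>+y. gamma_kernel J (a - 1 / 2) (sym_matrix (\<lambda>e\<in>edges J. t e + 1 * y e)) \<partial>edge_measure J) =
          (\<integral>\<^sup>+y. gamma_kernel J (a - 1 / 2) (sym_matrix y) \<partial>edge_measure J)"
        by (subst (2) nn_integral_PiM_affine[where c="\<lambda>_. 1" and t=t]) simp_all
      also have "(\<integral>\<^sup>+y. gamma_kernel J (a - 1 / 2) (sym_matrix y) \<partial>edge_measure J) = ennreal ?G"
        using a by (intro insert.IH) (simp add: field_simps)
      finally show "(\<integral>\<^sup>+y. gamma_kernel (insert k J) a (sym_matrix (merge ?K (edges J) (x, y))) \<partial>edge_measure J) =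
        ennreal (C x) * ennreal ?G" .
    qed
    also have "\<dots> = (\<integral>\<^sup>+x. ennreal (C x) \<partial>(\<Pi>\<^sub>M e \<in> ?K. lborel)) * ennreal ?G"
      by (rule nn_integral_multc) measurable
    \<comment> \<open>The pivot becomes the outer variable because the Gaussian integrals over its
      row depend on it.\<close>
    also have "(\<integral>\<^sup>+x. ennreal (C x) \<partial>(\<Pi>\<^sub>M e \<in> ?K. lborel)) =
        (\<integral>\<^sup>+s. \<integral>\<^sup>+x. ennreal (C (x({k} := s))) \<partial>(\<Pi>\<^sub>M e \<in> ?B. lborel) \<partial>lborel)"
      using kB by (intro product_nn_integral_insert_rev) simp_all
    also have "\<dots> = (\<integral>\<^sup>+s. ennreal (pi powr (real ?n / 2)) *
        ennreal (indicator {0..} s * s powr (a - 1) / exp s) \<partial>lborel)"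
    proof (rule nn_integral_cong)
      fix s :: real
      show "(\<integral>\<^sup>+x. ennreal (C (x({k} := s))) \<partial>(\<Pi>\<^sub>M e \<in> ?B. lborel)) =
        ennreal (pi powr (real ?n / 2)) * ennreal (indicator {0..} s * s powr (a - 1) / exp s)"
      proof (cases "0 < s")
        case False
        \<comment> \<open>Negative \<open>s\<close> is killed by the indicator; at zero both sides
          vanish because \<open>0 powr (a - 1) = 0\<close>.\<close>
        then show ?thesis by (cases "s = 0") (auto simp: C_def)
      next
        case True
        let ?c = "s powr (a - (real ?n + 2) / 2) * exp (- s)"
        have "C (x({k} := s)) = ?c * (\<Prod>e\<in>?B. exp (- ((x e)\<^sup>2 / s)))" for x
        proof -
          have "{k, j} \<noteq> {k}" if "j \<in> J" for j
            using that insert.hyps by (auto simp: doubleton_eq_iff)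
          then show ?thesis
            using True by (simp add: C_def prod.reindex[OF inj_on_star])
        qed
        then have "(\<integral>\<^sup>+x. ennreal (C (x({k} := s))) \<partial>(\<Pi>\<^sub>M e \<in> ?B. lborel)) =
            (\<integral>\<^sup>+x. ennreal ?c * (\<Prod>e\<in>?B. ennreal (exp (- ((x e)\<^sup>2 / s)))) \<partial>(\<Pi>\<^sub>M e \<in> ?B. lborel))"
          by (simp add: ennreal_mult prod_nonneg prod_ennreal)
        also have "\<dots> = ennreal ?c * (\<integral>\<^sup>+x. (\<Prod>e\<in>?B. ennreal (exp (- ((x e)\<^sup>2 / s)))) \<partial>(\<Pi>\<^sub>M e \<in> ?B. lborel))"
          by (intro nn_integral_cmult borel_measurable_prod_ennreal) simp
        also have "(\<integral>\<^sup>+x. (\<Prod>e\<in>?B. ennreal (exp (- ((x e)\<^sup>2 / s)))) \<partial>(\<Pi>\<^sub>M e \<in> ?B. lborel)) =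
            (\<Prod>e\<in>?B. \<integral>\<^sup>+y. ennreal (exp (- (y\<^sup>2 / s))) \<partial>lborel)"
          by (intro product_nn_integral_prod[where f="\<lambda>_ y. ennreal (exp (- (y\<^sup>2 / s)))"]) simp_all
        also have "\<dots> = ennreal (sqrt (pi * s) ^ ?n)"
          using True by (simp add: nn_integral_gaussian card_image[OF inj_on_star] ennreal_power)
        also have "sqrt (pi * s) ^ ?n = pi powr (real ?n / 2) * s powr (real ?n / 2)"
          using True by (simp add: powr_half_sqrt[symmetric] powr_powr powr_mult flip: powr_realpow)
        also have "ennreal ?c * ennreal \<dots> = ennreal (?c * \<dots>)"
          by (simp add: ennreal_mult)
        also have "?c * (pi powr (real ?n / 2) * s powr (real ?n / 2)) =
            pi powr (real ?n / 2) * (indicator {0..} s * s powr (a - 1) / exp s)"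
        proof -
          \<comment> \<open>The n Gaussian factors contribute n/2 to the exponent of the pivot,
            which leaves the exponent a - 1 of the Gamma integrand.\<close>
          have e: "s powr (a - (real ?n + 2) / 2) * s powr (real ?n / 2) = s powr (a - 1)"
            unfolding powr_add[symmetric]
            by (rule arg_cong[of _ _ "\<lambda>c. s powr c"]) (simp add: field_simps)
          have i: "indicator {0..} s = (1 :: real)" using True by simp
          have "?c * (pi powr (real ?n / 2) * s powr (real ?n / 2)) =
              pi powr (real ?n / 2) * ((s powr (a - (real ?n + 2) / 2) * s powr (real ?n / 2)) * exp (- s))"
            by (simp only: mult_ac)
          also have "\<dots> = pi powr (real ?n / 2) * (indicator {0..} s * s powr (a - 1) / exp s)"
            unfolding e i by (simp only: mult_1_left divide_inverse exp_minus)
          finally show ?thesis .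
        qed
        also have "ennreal \<dots> = ennreal (pi powr (real ?n / 2)) *
            ennreal (indicator {0..} s * s powr (a - 1) / exp s)"
          by (rule ennreal_mult) simp_all
        finally show ?thesis .
      qed
    qed
    also have "\<dots> = ennreal (pi powr (real ?n / 2)) * ennreal (Gamma a)"
      using a by (subst nn_integral_cmult) (simp_all add: Gamma_conv_nn_integral_real)
    also have "\<dots> * ennreal ?G = ennreal (multivariate_Gamma (card (insert k J)) a)"
    proof -
      have "0 < a" using a by (rule le_less_trans[rotated]) simp
      then have "0 < Gamma a" by (rule Gamma_real_pos)
      moreover have "0 < ?G" using a by (intro multivariate_Gamma_pos) (simp add: field_simps)
      ultimately show ?thesis
        using insert.hyps by (simp add: multivariate_Gamma_Suc ennreal_mult)
    qed
    finally show ?case .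
  qed
qed

section \<open>Wishart laws\<close>

text \<open>The Wishart density without its constant, for \<open>a\<close> half the degrees of
  freedom and \<open>A\<close> half the inverse scale matrix. Taking \<open>A = 0\<close> isolates
  the power of the determinant.\<close>

definition wishart_kernel :: "real^'p^'p \<Rightarrow> real \<Rightarrow> real^'p^'p \<Rightarrow> real" where
  "wishart_kernel A a X =
     (if pos_def X then det X powr (a - (real CARD('p) + 1) / 2) * exp (- trace (A ** X)) else 0)"

lemma wishart_kernel_nonneg [simp]: "0 \<le> wishart_kernel A a X"
  by (simp add: wishart_kernel_def)

lemma wishart_kernel_mat_1: "wishart_kernel (mat 1) a X = gamma_kernel UNIV a X"
  by (simp add: wishart_kernel_def gamma_kernel_def trace_def)

lemma borel_measurable_trace_mult [measurable]:
  fixes A :: "real^'p^'p"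
  shows "(\<lambda>X. trace (A ** X)) \<in> borel_measurable borel"
  unfolding trace_def matrix_matrix_mult_def
  by (intro borel_measurable_continuous_onI continuous_intros)

lemma borel_measurable_wishart_kernel [measurable]: "wishart_kernel A a \<in> borel_measurable borel"
  unfolding wishart_kernel_def[abs_def] by measurable

lemma trace_congruence:
  fixes A L X :: "real^'p^'p"
  shows "trace (A ** (L ** X ** transpose L)) = trace (transpose L ** A ** L ** X)"
  using trace_mul_sym[of "A ** L ** X" "transpose L"] by (simp add: matrix_mul_assoc)

lemma wishart_kernel_congruence:
  fixes L :: "real^'p^'p"
  assumes "det L \<noteq> 0"
  shows "wishart_kernel A a (L ** X ** transpose L) =
    ((det L)\<^sup>2) powr (a - (real CARD('p) + 1) / 2) * wishart_kernel (transpose L ** A ** L) a X"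
proof (cases "pos_def X")
  case True
  have "det (L ** X ** transpose L) = (det L)\<^sup>2 * det X"
    by (simp add: det_mul det_transpose power2_eq_square)
  then show ?thesis
    using True assms det_pos_def_pos[OF True]
    by (simp add: wishart_kernel_def pos_def_congruence trace_congruence powr_mult)
next
  case False
  then show ?thesis using assms by (simp add: wishart_kernel_def pos_def_congruence)
qed

text \<open>Serves to write the Jacobian, a power of the absolute value of \<open>det L\<close>, as
  a real power of the determinant of \<open>L ** transpose L\<close>.\<close>

lemma abs_power_eq_powr:
  fixes d :: real
  assumes "d \<noteq> 0"
  shows "\<bar>d\<bar> ^ n = (d\<^sup>2) powr (real n / 2)"
proof -
  have "d\<^sup>2 = \<bar>d\<bar> powr real 2"
    using assms by (subst powr_realpow) simp_all
  then have "(d\<^sup>2) powr (real n / 2) = \<bar>d\<bar> powr real n"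
    by (simp only: powr_powr) simp
  then show ?thesis using assms by (simp add: powr_realpow)
qed

text \<open>Writing the inverse \<open>S\<close> of \<open>A\<close> as
  \<open>L ** transpose L\<close> and substituting by congruence with \<open>L\<close> turns
  \<open>A\<close> into the identity, which leaves the multivariate Gamma integral. The Jacobian
  cancels the shift (p + 1)/2 in the exponent of \<open>det S\<close>.\<close>

lemma nn_integral_wishart_kernel:
  fixes S :: "real^'p^'p"
  assumes S: "pos_def S" and A: "A ** S = mat 1" and a: "(real CARD('p) - 1) / 2 < a"
  shows "(\<integral>\<^sup>+X. wishart_kernel A a X \<partial>sym_lborel) = ennreal (det S powr a * multivariate_Gamma CARD('p) a)"
proof -
  obtain L where L: "L \<in> elementary_products" "S = L ** transpose L"
    using S by (rule pos_def_factorization)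
  have d: "det L \<noteq> 0" by (rule det_elementary_products[OF L(1)])
  have dS: "det S = (det L)\<^sup>2" by (simp add: L(2) det_mul det_transpose power2_eq_square)
  let ?p = "real CARD('p)"
  have "(A ** L) ** transpose L = mat 1" using A by (simp add: L(2) matrix_mul_assoc)
  then have "transpose L ** (A ** L) = mat 1" using matrix_left_right_inverse by blast
  then have one: "transpose L ** A ** L = mat 1" by (simp add: matrix_mul_assoc)
  have "(\<integral>\<^sup>+X. wishart_kernel A a X \<partial>sym_lborel) = ennreal (\<bar>det L\<bar> ^ (CARD('p) + 1)) *
      (\<integral>\<^sup>+X. wishart_kernel A a (L ** X ** transpose L) \<partial>sym_lborel)"
    by (intro nn_integral_sym_lborel_congruence L(1)) measurable
  also have "(\<integral>\<^sup>+X. wishart_kernel A a (L ** X ** transpose L) \<partial>sym_lborel) =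
      (\<integral>\<^sup>+X. ennreal (det S powr (a - (?p + 1) / 2)) * wishart_kernel (mat 1 :: real^'p^'p) a X \<partial>sym_lborel)"
    by (simp add: wishart_kernel_congruence[OF d] one dS ennreal_mult)
  also have "\<dots> = ennreal (det S powr (a - (?p + 1) / 2)) *
      (\<integral>\<^sup>+X. wishart_kernel (mat 1 :: real^'p^'p) a X \<partial>sym_lborel)"
    by (rule nn_integral_cmult) measurable
  also have "(\<integral>\<^sup>+X. wishart_kernel (mat 1 :: real^'p^'p) a X \<partial>sym_lborel) =
      (\<integral>\<^sup>+x. wishart_kernel (mat 1) a (sym_matrix x) \<partial>edge_measure (UNIV :: 'p set))"
    by (rule nn_integral_sym_lborel) measurable
  also have "\<dots> = ennreal (multivariate_Gamma CARD('p) a)"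
    unfolding wishart_kernel_mat_1 by (rule nn_integral_gamma_kernel[OF a])
  also have "\<bar>det L\<bar> ^ (CARD('p) + 1) = det S powr ((?p + 1) / 2)"
    unfolding dS using abs_power_eq_powr[OF d, of "CARD('p) + 1"] by (simp only: of_nat_add of_nat_1)
  also have "ennreal (det S powr ((?p + 1) / 2)) *
      (ennreal (det S powr (a - (?p + 1) / 2)) * ennreal (multivariate_Gamma CARD('p) a)) =
      ennreal (det S powr a * multivariate_Gamma CARD('p) a)"
    using multivariate_Gamma_pos[OF a]
    by (simp add: ennreal_mult[symmetric] mult.assoc[symmetric] powr_add[symmetric])
  finally show ?thesis .
qed

section \<open>The matrix Beta integral and convolution of kernels\<close>

definition matrix_beta :: "'p::finite itself \<Rightarrow> real \<Rightarrow> real \<Rightarrow> ennreal" where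
  "matrix_beta _ a b =
     (\<integral>\<^sup>+Y. ennreal (wishart_kernel (0 :: real^'p^'p) a Y) * ennreal (wishart_kernel 0 b (mat 1 - Y))
       \<partial>sym_lborel)"

lemma wishart_kernel_split: "wishart_kernel A a X = exp (- trace (A ** X)) * wishart_kernel 0 a X"
  by (simp add: wishart_kernel_def trace_def matrix_matrix_mult_def)

lemma matrix_add_rdistrib:
  fixes A B C :: "real^'p^'p"
  shows "(A + B) ** C = A ** C + B ** C"
  by (simp add: matrix_matrix_mult_def vec_eq_iff distrib_right sum.distrib)

text \<open>A product of nonzero kernels needs \<open>X\<close> and \<open>S - X\<close>, hence
  \<open>S\<close>, positive definite. Then the exponentials combine to a constant in
  \<open>X\<close>, and \<open>X = L ** Y ** transpose L\<close> gives
  \<open>S - X = L ** (mat 1 - Y) ** transpose L\<close>, so \<open>S\<close> enters only through a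
  power of its determinant.\<close>

lemma nn_integral_wishart_kernel_mult:
  fixes S :: "real^'p^'p"
  shows "(\<integral>\<^sup>+X. ennreal (wishart_kernel A a X) * ennreal (wishart_kernel A b (S - X)) \<partial>sym_lborel) =
    matrix_beta TYPE('p) a b * wishart_kernel A (a + b) S"
proof (cases "pos_def S")
  case False
  have "wishart_kernel A a X * wishart_kernel A b (S - X) = 0" for X
    using False pos_def_add[of X "S - X"] by (auto simp: wishart_kernel_def)
  then have 0: "ennreal (wishart_kernel A a X) * ennreal (wishart_kernel A b (S - X)) = 0" for X
    by (simp add: ennreal_mult[symmetric])
  have "wishart_kernel A (a + b) S = 0"
    using False by (simp add: wishart_kernel_def)
  then show ?thesis unfolding 0 by simp
next
  case True
  then obtain L where L: "L \<in> elementary_products" "S = L ** transpose L"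
    by (rule pos_def_factorization)
  have d: "det L \<noteq> 0" by (rule det_elementary_products[OF L(1)])
  have dS: "det S = (det L)\<^sup>2" by (simp add: L(2) det_mul det_transpose power2_eq_square)
  let ?q = "(real CARD('p) + 1) / 2"
  let ?E = "exp (- trace (A ** S))"
  have "wishart_kernel A a X * wishart_kernel A b (S - X) =
      ?E * (wishart_kernel 0 a X * wishart_kernel 0 b (S - X))" for X
  proof -
    have "A ** S = A ** X + A ** (S - X)" by (simp add: matrix_add_ldistrib[symmetric])
    then have "?E = exp (- trace (A ** X)) * exp (- trace (A ** (S - X)))"
      by (simp add: trace_add exp_add[symmetric])
    then show ?thesis
      by (simp add: wishart_kernel_split[of A])
  qed
  then have "(\<integral>\<^sup>+X. ennreal (wishart_kernel A a X) * ennreal (wishart_kernel A b (S - X)) \<partial>sym_lborel) =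
      (\<integral>\<^sup>+X. ennreal ?E * (ennreal (wishart_kernel 0 a X) * ennreal (wishart_kernel 0 b (S - X))) \<partial>sym_lborel)"
    by (simp add: ennreal_mult[symmetric])
  also have "\<dots> = ennreal ?E *
      (\<integral>\<^sup>+X. ennreal (wishart_kernel 0 a X) * ennreal (wishart_kernel 0 b (S - X)) \<partial>sym_lborel)"
    by (rule nn_integral_cmult) measurable
  also have "(\<integral>\<^sup>+X. ennreal (wishart_kernel 0 a X) * ennreal (wishart_kernel 0 b (S - X)) \<partial>sym_lborel) =
      ennreal (\<bar>det L\<bar> ^ (CARD('p) + 1)) *
      (\<integral>\<^sup>+Y. ennreal (wishart_kernel 0 a (L ** Y ** transpose L)) *
         ennreal (wishart_kernel 0 b (S - L ** Y ** transpose L)) \<partial>sym_lborel)"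
    by (intro nn_integral_sym_lborel_congruence L(1)) measurable
  also have "(\<integral>\<^sup>+Y. ennreal (wishart_kernel 0 a (L ** Y ** transpose L)) *
         ennreal (wishart_kernel 0 b (S - L ** Y ** transpose L)) \<partial>sym_lborel) =
      (\<integral>\<^sup>+Y. ennreal (det S powr (a - ?q) * det S powr (b - ?q)) *
         (ennreal (wishart_kernel (0 :: real^'p^'p) a Y) * ennreal (wishart_kernel 0 b (mat 1 - Y))) \<partial>sym_lborel)"
  proof (rule nn_integral_cong)
    fix Y :: "real^'p^'p"
    have "L ** (mat 1 - Y) ** transpose L + L ** Y ** transpose L = S"
      by (simp add: L(2) matrix_add_ldistrib[symmetric] matrix_add_rdistrib[symmetric])
    then have "S - L ** Y ** transpose L = L ** (mat 1 - Y) ** transpose L"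
      by (simp add: algebra_simps)
    moreover have "transpose L ** 0 ** L = 0"
      by (simp add: matrix_matrix_mult_def vec_eq_iff)
    ultimately show "ennreal (wishart_kernel 0 a (L ** Y ** transpose L)) *
         ennreal (wishart_kernel 0 b (S - L ** Y ** transpose L)) =
        ennreal (det S powr (a - ?q) * det S powr (b - ?q)) *
         (ennreal (wishart_kernel 0 a Y) * ennreal (wishart_kernel 0 b (mat 1 - Y)))"
      by (simp add: wishart_kernel_congruence[OF d] dS ennreal_mult[symmetric] mult_ac)
  qed
  also have "\<dots> = ennreal (det S powr (a - ?q) * det S powr (b - ?q)) * matrix_beta TYPE('p) a b"
    unfolding matrix_beta_def by (rule nn_integral_cmult) measurable
  also have "\<bar>det L\<bar> ^ (CARD('p) + 1) = det S powr ?q"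
    unfolding dS using abs_power_eq_powr[OF d, of "CARD('p) + 1"] by (simp only: of_nat_add of_nat_1)
  also have "ennreal ?E * (ennreal (det S powr ?q) *
      (ennreal (det S powr (a - ?q) * det S powr (b - ?q)) * matrix_beta TYPE('p) a b)) =
      matrix_beta TYPE('p) a b * ennreal (?E * (det S powr ?q * (det S powr (a - ?q) * det S powr (b - ?q))))"
    by (simp add: ennreal_mult mult_ac)
  \<comment> \<open>The Jacobian contributes \<open>?q\<close> and the kernels \<open>a - ?q\<close>
    and \<open>b - ?q\<close>, so the exponent of the kernel for \<open>a + b\<close>
    results.\<close>
  also have "det S powr ?q * (det S powr (a - ?q) * det S powr (b - ?q)) = det S powr (a + b - ?q)"
    unfolding powr_add[symmetric] by (rule arg_cong[of _ _ "\<lambda>c. det S powr c"]) (simp add: add_divide_distrib)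
  also have "?E * \<dots> = wishart_kernel A (a + b) S"
    using True by (simp add: wishart_kernel_def)
  finally show ?thesis .
qed

section \<open>Tonelli for symmetric matrices and the value of the Beta integral\<close>

lemma sigma_finite_edge_measure: "sigma_finite_measure (edge_measure (J :: 'p::finite set))"
proof -
  interpret product_sigma_finite "\<lambda>_. lborel :: real measure" by (rule product_sigma_finite_lborel)
  show ?thesis by (rule sigma_finite) simp
qed

text \<open>A pushforward need not inherit sigma-finiteness, so the integral is pulled back to the
  edge coordinates, where the product measure is sigma-finite.\<close>

lemma borel_measurable_nn_integral_sym_lborel:
  fixes f :: "'a \<Rightarrow> real^'p^'p \<Rightarrow> ennreal"
  assumes f: "(\<lambda>(x, Y). f x Y) \<in> borel_measurable (M \<Otimes>\<^sub>M borel)"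
  shows "(\<lambda>x. \<integral>\<^sup>+Y. f x Y \<partial>sym_lborel) \<in> borel_measurable M"
proof -
  interpret sigma_finite_measure "edge_measure (UNIV :: 'p set)" by (rule sigma_finite_edge_measure)
  have [measurable]: "(\<lambda>z. f (fst z) (sym_matrix (snd z))) \<in> borel_measurable (M \<Otimes>\<^sub>M edge_measure UNIV)"
    using measurable_compose[OF measurable_Pair[OF measurable_fst
        measurable_compose[OF measurable_snd measurable_sym_matrix]] f] by simp
  have "(\<lambda>x. \<integral>\<^sup>+y. f x (sym_matrix y) \<partial>edge_measure UNIV) \<in> borel_measurable M"
    by (rule borel_measurable_nn_integral) (simp add: split_beta')
  also have "?this \<longleftrightarrow> ?thesis"
    using measurable_compose[OF measurable_Pair1' f]
    by (intro measurable_cong nn_integral_sym_lborel[symmetric]) simp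
  finally show ?thesis .
qed

lemma nn_integral_sym_lborel_swap:
  fixes f :: "real^'p^'p \<Rightarrow> real^'p^'p \<Rightarrow> ennreal"
  assumes f: "(\<lambda>(X, Y). f X Y) \<in> borel_measurable (borel \<Otimes>\<^sub>M borel)"
  shows "(\<integral>\<^sup>+X. \<integral>\<^sup>+Y. f X Y \<partial>sym_lborel \<partial>sym_lborel) = (\<integral>\<^sup>+Y. \<integral>\<^sup>+X. f X Y \<partial>sym_lborel \<partial>sym_lborel)"
proof -
  interpret pair_sigma_finite "edge_measure (UNIV :: 'p set)" "edge_measure (UNIV :: 'p set)"
    by (simp add: pair_sigma_finite_def sigma_finite_edge_measure)
  have f': "(\<lambda>(Y, X). f X Y) \<in> borel_measurable (borel \<Otimes>\<^sub>M borel)"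
    using measurable_compose[OF measurable_pair_swap' f] by (simp add: split_beta')
  have to_edges: "(\<integral>\<^sup>+X. \<integral>\<^sup>+Y. g X Y \<partial>sym_lborel \<partial>sym_lborel) =
      (\<integral>\<^sup>+x. \<integral>\<^sup>+y. g (sym_matrix x) (sym_matrix y) \<partial>edge_measure UNIV \<partial>edge_measure UNIV)"
    if g: "(\<lambda>(X, Y). g X Y) \<in> borel_measurable (borel \<Otimes>\<^sub>M borel)" for g :: "real^'p^'p \<Rightarrow> real^'p^'p \<Rightarrow> ennreal"
    using measurable_compose[OF measurable_Pair1' g]
    by (subst nn_integral_sym_lborel[OF borel_measurable_nn_integral_sym_lborel[OF g]])
       (intro nn_integral_cong nn_integral_sym_lborel, simp)
  have "(\<lambda>(x, y). f (sym_matrix x) (sym_matrix y)) \<in> borel_measurable (edge_measure UNIV \<Otimes>\<^sub>M edge_measure UNIV)"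
    using measurable_compose[OF measurable_Pair[OF measurable_compose[OF measurable_fst measurable_sym_matrix]
        measurable_compose[OF measurable_snd measurable_sym_matrix]] f] by (simp add: split_beta')
  from Fubini'[OF this] show ?thesis
    unfolding to_edges[OF f] to_edges[OF f'] ..
qed

text \<open>The inner variable is replaced by the sum, \<open>S = X + Y\<close>, and the order of
  integration is exchanged; the integral over \<open>X\<close> is then the kernel convolution at
  \<open>S\<close>.\<close>

lemma wishart_kernel_convolution:
  fixes f :: "real^'p^'p \<Rightarrow> ennreal"
  assumes [measurable]: "f \<in> borel_measurable borel"
  shows "(\<integral>\<^sup>+X. ennreal (wishart_kernel A a X) *
      (\<integral>\<^sup>+Y. ennreal (wishart_kernel A b Y) * f (X + Y) \<partial>sym_lborel) \<partial>sym_lborel) =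
    matrix_beta TYPE('p) a b * (\<integral>\<^sup>+S. ennreal (wishart_kernel A (a + b) S) * f S \<partial>sym_lborel)"
proof -
  let ?k = "\<lambda>a X. ennreal (wishart_kernel A a X)"
  have "(\<integral>\<^sup>+X. ?k a X * (\<integral>\<^sup>+Y. ?k b Y * f (X + Y) \<partial>sym_lborel) \<partial>sym_lborel) =
      (\<integral>\<^sup>+X. \<integral>\<^sup>+S. ?k a X * ?k b (S - X) * f S \<partial>sym_lborel \<partial>sym_lborel)"
  proof (rule nn_integral_cong)
    fix X :: "real^'p^'p"
    show "?k a X * (\<integral>\<^sup>+Y. ?k b Y * f (X + Y) \<partial>sym_lborel) =
        (\<integral>\<^sup>+S. ?k a X * ?k b (S - X) * f S \<partial>sym_lborel)"
    \<comment> \<open>Translation invariance holds for symmetric shifts only; for \<open>X\<close>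
      that is not positive definite the kernel vanishes anyway.\<close>
    proof (cases "pos_def X")
      case False
      then show ?thesis by (simp add: wishart_kernel_def)
    next
      case True
      have "transpose (- X) = - X"
        using True by (simp add: pos_def_def transpose_def vec_eq_iff)
      then have "(\<integral>\<^sup>+Y. ?k b Y * f (X + Y) \<partial>sym_lborel) =
          (\<integral>\<^sup>+S. ?k b (- X + S) * f (X + (- X + S)) \<partial>sym_lborel)"
        by (intro nn_integral_sym_lborel_translate) measurable
      then have "?k a X * (\<integral>\<^sup>+Y. ?k b Y * f (X + Y) \<partial>sym_lborel) =
          ?k a X * (\<integral>\<^sup>+S. ?k b (S - X) * f S \<partial>sym_lborel)"
        by (simp add: add.assoc[symmetric])
      also have "\<dots> = (\<integral>\<^sup>+S. ?k a X * (?k b (S - X) * f S) \<partial>sym_lborel)"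
        by (rule nn_integral_cmult[symmetric]) measurable
      finally show ?thesis by (simp add: mult.assoc)
    qed
  qed
  also have "\<dots> = (\<integral>\<^sup>+S. \<integral>\<^sup>+X. ?k a X * ?k b (S - X) * f S \<partial>sym_lborel \<partial>sym_lborel)"
    by (rule nn_integral_sym_lborel_swap) measurable
  also have "\<dots> = (\<integral>\<^sup>+S. matrix_beta TYPE('p) a b * (?k (a + b) S * f S) \<partial>sym_lborel)"
  proof (rule nn_integral_cong)
    fix S :: "real^'p^'p"
    have "(\<integral>\<^sup>+X. ?k a X * ?k b (S - X) * f S \<partial>sym_lborel) = (\<integral>\<^sup>+X. ?k a X * ?k b (S - X) \<partial>sym_lborel) * f S"
      by (rule nn_integral_multc) measurable
    then show "(\<integral>\<^sup>+X. ?k a X * ?k b (S - X) * f S \<partial>sym_lborel) = matrix_beta TYPE('p) a b * (?k (a + b) S * f S)"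
      by (simp only: nn_integral_wishart_kernel_mult mult.assoc)
  qed
  also have "\<dots> = matrix_beta TYPE('p) a b * (\<integral>\<^sup>+S. ?k (a + b) S * f S \<partial>sym_lborel)"
    by (rule nn_integral_cmult) measurable
  finally show ?thesis .
qed

text \<open>The convolution identity for the constant function 1 and the identity matrix compares
  total masses, which are all Gamma values.\<close>

lemma matrix_beta_eq:
  fixes a b :: real
  assumes "(real CARD('p::finite) - 1) / 2 < a" "(real CARD('p) - 1) / 2 < b"
  shows "matrix_beta TYPE('p) a b = ennreal (multivariate_Gamma CARD('p) a * multivariate_Gamma CARD('p) b /
    multivariate_Gamma CARD('p) (a + b))"
proof -
  let ?G = "multivariate_Gamma CARD('p)"
  have "0 \<le> (real CARD('p) - 1) / 2"
    using zero_less_card_finite[where 'a='p] by simp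
  then have "0 < a" using assms(1) by (rule le_less_trans)
  then have "0 \<le> a" by (rule less_imp_le)
  then have ab: "(real CARD('p) - 1) / 2 < a + b"
    using assms(2) by (rule add_strict_increasing2)
  have 1: "pos_def (mat 1 :: real^'p^'p)" by (simp add: pos_def_def transpose_mat)
  have int: "(\<integral>\<^sup>+X. wishart_kernel (mat 1 :: real^'p^'p) c X \<partial>sym_lborel) = ennreal (?G c)"
    if "(real CARD('p) - 1) / 2 < c" for c
    using nn_integral_wishart_kernel[OF 1 _ that, of "mat 1"] by simp
  have "matrix_beta TYPE('p) a b * ennreal (?G (a + b)) = ennreal (?G a) * ennreal (?G b)"
    using wishart_kernel_convolution[of "\<lambda>_. 1" "mat 1 :: real^'p^'p" a b]
    by (simp add: int[OF assms(1)] int[OF assms(2)] int[OF ab] nn_integral_multc)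
  then have eq: "matrix_beta TYPE('p) a b * ennreal (?G (a + b)) = ennreal (?G a * ?G b)"
    using multivariate_Gamma_pos[OF assms(1)] by (simp add: ennreal_mult')
  have pos: "0 < ?G (a + b)" by (rule multivariate_Gamma_pos[OF ab])
  show ?thesis
  proof (cases "matrix_beta TYPE('p) a b" rule: ennreal_cases)
    case (real r)
    then have "ennreal (r * ?G (a + b)) = ennreal (?G a * ?G b)"
      using eq by (simp add: ennreal_mult')
    then have "r * ?G (a + b) = ?G a * ?G b"
      using real pos multivariate_Gamma_pos[OF assms(1)] multivariate_Gamma_pos[OF assms(2)]
      by (subst (asm) ennreal_inj) simp_all
    then have "r = ?G a * ?G b / ?G (a + b)"
      using pos by (simp add: eq_divide_eq)
    then show ?thesis using real by simp
  next
    \<comment> \<open>An infinite Beta value times a positive Gamma value would be infinite, against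
      the finite right-hand side.\<close>
    case top
    then show ?thesis using eq pos by (simp add: ennreal_top_mult)
  qed
qed

lemma ennreal_mult3:
  "0 \<le> x \<Longrightarrow> 0 \<le> y \<Longrightarrow> 0 \<le> z \<Longrightarrow>
    ennreal x * (ennreal y * (ennreal z * R)) = ennreal (x * (y * z)) * R"
  by (simp add: ennreal_mult mult.assoc)

lemma det_scaleR:
  fixes A :: "real^'p^'p"
  shows "det (c *\<^sub>R A) = c ^ CARD('p) * det A"
  unfolding det_def by (simp add: prod.distrib sum_distrib_left mult_ac)

section \<open>Normalized Wishart laws for a fixed scale matrix\<close>

context
  fixes \<Sigma> :: "real^'p^'p"
  assumes \<Sigma>: "pos_def \<Sigma>"
begin

lemma matrix_inv_mult: "matrix_inv \<Sigma> ** \<Sigma> = mat 1"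
proof -
  have "\<exists>B. \<Sigma> ** B = mat 1 \<and> B ** \<Sigma> = mat 1"
    using det_pos_def_pos[OF \<Sigma>] invertible_det_nz[of \<Sigma>] by (auto simp: invertible_def)
  then show ?thesis unfolding matrix_inv_def by (rule someI2_ex) simp
qed

text \<open>The identity holds pointwise: on singular semidefinite matrices the density is zero
  because \<open>0 powr\<close> any exponent is 0. The two scalar factors of the constant combine to
  a power of \<open>det (2 *\<^sub>R \<Sigma>)\<close>.\<close>

lemma wishart_density_eq:
  "wishart_density \<Sigma> n X =
    wishart_kernel ((1 / 2) *\<^sub>R matrix_inv \<Sigma>) (n / 2) X /
      (det (2 *\<^sub>R \<Sigma>) powr (n / 2) * multivariate_Gamma CARD('p) (n / 2))"
proof -
  let ?p = "real CARD('p)"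
  have d: "det (2 *\<^sub>R \<Sigma>) powr (n / 2) = 2 powr (n * ?p / 2) * det \<Sigma> powr (n / 2)"
    using det_pos_def_pos[OF \<Sigma>]
    by (simp add: det_scaleR powr_mult powr_powr mult.commute flip: powr_realpow)
  have t: "trace ((1 / 2) *\<^sub>R matrix_inv \<Sigma> ** X) = 1 / 2 * trace (matrix_inv \<Sigma> ** X)"
    by (simp add: trace_def sum_distrib_left flip: scalar_matrix_assoc)
  have e: "(n - ?p - 1) / 2 = n / 2 - (?p + 1) / 2" by (simp add: field_simps)
  show ?thesis
    unfolding wishart_density_def wishart_kernel_def pos_def_iff Let_def d t e by simp
qed

lemma borel_measurable_wishart_density [measurable]: "wishart_density \<Sigma> n \<in> borel_measurable borel"
  unfolding wishart_density_eq[abs_def] by measurable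

lemma sets_wishart_law [simp, measurable_cong]: "sets (wishart_law \<Sigma> n) = sets borel"
  by (simp add: wishart_law_def)

lemma space_wishart_law [simp]: "space (wishart_law \<Sigma> n) = UNIV"
  by (simp add: wishart_law_def)

text \<open>For \<open>n\<close> above p - 1 every Gamma factor is positive, so the normalizing
  constant is nonnegative and can be taken out of the integral.\<close>

lemma nn_integral_wishart_law:
  assumes n: "real CARD('p) - 1 < n" and [measurable]: "f \<in> borel_measurable borel"
  shows "(\<integral>\<^sup>+X. f X \<partial>wishart_law \<Sigma> n) =
    ennreal (1 / (det (2 *\<^sub>R \<Sigma>) powr (n / 2) * multivariate_Gamma CARD('p) (n / 2))) *
    (\<integral>\<^sup>+X. ennreal (wishart_kernel ((1 / 2) *\<^sub>R matrix_inv \<Sigma>) (n / 2) X) * f X \<partial>sym_lborel)"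
proof -
  have pos: "0 < multivariate_Gamma CARD('p) (n / 2)"
    using n by (intro multivariate_Gamma_pos) simp
  let ?c = "1 / (det (2 *\<^sub>R \<Sigma>) powr (n / 2) * multivariate_Gamma CARD('p) (n / 2))"
  have "ennreal (wishart_density \<Sigma> n X) =
      ennreal ?c * ennreal (wishart_kernel ((1 / 2) *\<^sub>R matrix_inv \<Sigma>) (n / 2) X)" for X
    using pos by (simp add: wishart_density_eq ennreal_mult[symmetric])
  then have "(\<integral>\<^sup>+X. f X \<partial>wishart_law \<Sigma> n) =
      (\<integral>\<^sup>+X. ennreal ?c * (ennreal (wishart_kernel ((1 / 2) *\<^sub>R matrix_inv \<Sigma>) (n / 2) X) * f X) \<partial>sym_lborel)"
    unfolding wishart_law_def by (subst nn_integral_density) (simp_all add: mult.assoc)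
  also have "\<dots> = ennreal ?c *
      (\<integral>\<^sup>+X. ennreal (wishart_kernel ((1 / 2) *\<^sub>R matrix_inv \<Sigma>) (n / 2) X) * f X \<partial>sym_lborel)"
    by (rule nn_integral_cmult) measurable
  finally show ?thesis .
qed

lemma half_inv_mult: "(1 / 2) *\<^sub>R matrix_inv \<Sigma> ** (2 *\<^sub>R \<Sigma>) = mat 1"
  by (simp add: matrix_scalar_ac matrix_inv_mult flip: scalar_matrix_assoc)

lemma prob_space_wishart_law:
  assumes n: "real CARD('p) - 1 < n"
  shows "prob_space (wishart_law \<Sigma> n)"
proof
  have 2: "pos_def (2 *\<^sub>R \<Sigma>)" using \<Sigma> by (intro pos_def_scaleR) simp_all
  have n': "(real CARD('p) - 1) / 2 < n / 2" using n by simp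
  have "emeasure (wishart_law \<Sigma> n) UNIV = (\<integral>\<^sup>+X. 1 \<partial>wishart_law \<Sigma> n)" by simp
  also have "\<dots> = 1"
    using nn_integral_wishart_kernel[OF 2 half_inv_mult n'] multivariate_Gamma_pos[OF n'] det_pos_def_pos[OF 2]
    by (subst nn_integral_wishart_law[OF n]) (simp_all add: ennreal_mult[symmetric])
  finally show "emeasure (wishart_law \<Sigma> n) (space (wishart_law \<Sigma> n)) = 1" by simp
qed

text \<open>After the kernel convolution only constants remain: the determinant powers add, and the
  Beta value replaces the Gamma values of \<open>n\<close> and \<open>m\<close> by that of
  \<open>n + m\<close>.\<close>

lemma convolution_wishart_law:
  assumes n: "real CARD('p) - 1 < n" and m: "real CARD('p) - 1 < m"
  shows "convolution (wishart_law \<Sigma> n) (wishart_law \<Sigma> m) = wishart_law \<Sigma> (n + m)"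
proof (rule measure_eqI)
  fix B assume "B \<in> sets (convolution (wishart_law \<Sigma> n) (wishart_law \<Sigma> m))"
  then have [measurable]: "B \<in> sets borel" by simp
  interpret N: prob_space "wishart_law \<Sigma> n" by (rule prob_space_wishart_law[OF n])
  interpret M: prob_space "wishart_law \<Sigma> m" by (rule prob_space_wishart_law[OF m])
  let ?G = "\<lambda>n. multivariate_Gamma CARD('p) (n / 2)"
  let ?D = "\<lambda>n. det (2 *\<^sub>R \<Sigma>) powr (n / 2)"
  let ?c = "\<lambda>n. 1 / (?D n * ?G n)"
  let ?k = "\<lambda>n X. ennreal (wishart_kernel ((1 / 2) *\<^sub>R matrix_inv \<Sigma>) (n / 2) X)"
  have p: "1 \<le> real CARD('p)"
    using zero_less_card_finite[where 'a='p] by linarith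
  \<comment> \<open>Adding the two bounds gives 2 (p - 1), which is at least p - 1 because p is at
    least 1.\<close>
  have nm: "real CARD('p) - 1 < n + m" using n m p by linarith
  have pos: "0 < ?G l" if "real CARD('p) - 1 < l" for l
    using that by (intro multivariate_Gamma_pos) simp
  have D: "0 < ?D l" for l
    using det_pos_def_pos[OF \<Sigma>] by (simp add: det_scaleR)
  have meas: "(\<lambda>X. \<integral>\<^sup>+Y. ?k m Y * indicator B (X + Y) \<partial>sym_lborel) \<in> borel_measurable borel"
    by (rule borel_measurable_nn_integral_sym_lborel) measurable
  have "emeasure (convolution (wishart_law \<Sigma> n) (wishart_law \<Sigma> m)) B =
      (\<integral>\<^sup>+X. \<integral>\<^sup>+Y. indicator B (X + Y) \<partial>wishart_law \<Sigma> m \<partial>wishart_law \<Sigma> n)"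
    by (rule convolution_emeasure') (simp_all add: N.finite_measure_axioms M.finite_measure_axioms)
  also have "\<dots> = (\<integral>\<^sup>+X. ennreal (?c m) * (\<integral>\<^sup>+Y. ?k m Y * indicator B (X + Y) \<partial>sym_lborel) \<partial>wishart_law \<Sigma> n)"
    by (intro nn_integral_cong nn_integral_wishart_law[OF m]) measurable
  also have "\<dots> = ennreal (?c n) * (\<integral>\<^sup>+X. ?k n X *
      (ennreal (?c m) * (\<integral>\<^sup>+Y. ?k m Y * indicator B (X + Y) \<partial>sym_lborel)) \<partial>sym_lborel)"
    by (intro nn_integral_wishart_law[OF n] borel_measurable_times_ennreal meas) simp
  also have "\<dots> = ennreal (?c n) * (\<integral>\<^sup>+X. ennreal (?c m) *
      (?k n X * (\<integral>\<^sup>+Y. ?k m Y * indicator B (X + Y) \<partial>sym_lborel)) \<partial>sym_lborel)"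
    by (simp only: mult.left_commute)
  also have "\<dots> = ennreal (?c n) * (ennreal (?c m) * (\<integral>\<^sup>+X.
      ?k n X * (\<integral>\<^sup>+Y. ?k m Y * indicator B (X + Y) \<partial>sym_lborel) \<partial>sym_lborel))"
    using meas by (subst nn_integral_cmult) simp_all
  also have "(\<integral>\<^sup>+X. ?k n X * (\<integral>\<^sup>+Y. ?k m Y * indicator B (X + Y) \<partial>sym_lborel) \<partial>sym_lborel) =
      matrix_beta TYPE('p) (n / 2) (m / 2) * (\<integral>\<^sup>+S. ?k (n + m) S * indicator B S \<partial>sym_lborel)"
    using wishart_kernel_convolution[of "indicator B" "(1 / 2) *\<^sub>R matrix_inv \<Sigma>" "n / 2" "m / 2"]
    by (simp add: add_divide_distrib)
  also have "matrix_beta TYPE('p) (n / 2) (m / 2) = ennreal (?G n * ?G m / ?G (n + m))"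
    using matrix_beta_eq[where 'p='p, of "n / 2" "m / 2"] n m by (simp add: add_divide_distrib)
  also have "ennreal (?c n) * (ennreal (?c m) * (ennreal (?G n * ?G m / ?G (n + m)) * R)) =
      ennreal (?c (n + m)) * R" for R
  proof -
    have "?c n * (?c m * (?G n * ?G m / ?G (n + m))) = ?c (n + m)"
      using pos[OF n] pos[OF m] pos[OF nm] D[of n] D[of m] D[of "n + m"]
      by (simp add: add_divide_distrib powr_add)
    moreover have "ennreal (?c n) * (ennreal (?c m) * (ennreal (?G n * ?G m / ?G (n + m)) * R)) =
        ennreal (?c n * (?c m * (?G n * ?G m / ?G (n + m)))) * R"
      using pos[OF n] pos[OF m] pos[OF nm] by (intro ennreal_mult3) simp_all
    ultimately show ?thesis by simp
  qed
  also have "ennreal (?c (n + m)) * (\<integral>\<^sup>+S. ?k (n + m) S * indicator B S \<partial>sym_lborel) =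
      (\<integral>\<^sup>+S. indicator B S \<partial>wishart_law \<Sigma> (n + m))"
    by (rule nn_integral_wishart_law[OF nm, symmetric]) measurable
  finally show "emeasure (convolution (wishart_law \<Sigma> n) (wishart_law \<Sigma> m)) B = emeasure (wishart_law \<Sigma> (n + m)) B"
    by simp
qed simp

text \<open>The exponential factor doubles the matrix in the kernel, from half the inverse of the
  scale matrix to the inverse itself. The quotient of the two masses is a power of 2 that is
  strictly monotone in \<open>n\<close>, so this single value identifies the law.\<close>

lemma wishart_law_laplace:
  assumes n: "real CARD('p) - 1 < n"
  shows "(\<integral>\<^sup>+X. ennreal (exp (- trace ((1 / 2) *\<^sub>R matrix_inv \<Sigma> ** X))) \<partial>wishart_law \<Sigma> n) =
    ennreal (2 powr (- (n * real CARD('p) / 2)))"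
proof -
  let ?A = "(1 / 2) *\<^sub>R matrix_inv \<Sigma>"
  let ?G = "multivariate_Gamma CARD('p) (n / 2)"
  have n': "(real CARD('p) - 1) / 2 < n / 2" using n by simp
  have G: "0 < ?G" by (rule multivariate_Gamma_pos[OF n'])
  have d: "0 < det \<Sigma>" by (rule det_pos_def_pos[OF \<Sigma>])
  have "trace (matrix_inv \<Sigma> ** X) = trace (?A ** X) + trace (?A ** X)" for X
    by (simp add: trace_def sum_distrib_left sum.distrib[symmetric] flip: scalar_matrix_assoc)
  then have k: "ennreal (wishart_kernel ?A (n / 2) X) * ennreal (exp (- trace (?A ** X))) =
      ennreal (wishart_kernel (matrix_inv \<Sigma>) (n / 2) X)" for X
    by (simp add: wishart_kernel_def ennreal_mult[symmetric] exp_add[symmetric] mult.assoc)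
  have "(\<integral>\<^sup>+X. ennreal (exp (- trace (?A ** X))) \<partial>wishart_law \<Sigma> n) =
      ennreal (1 / (det (2 *\<^sub>R \<Sigma>) powr (n / 2) * ?G)) * ennreal (det \<Sigma> powr (n / 2) * ?G)"
    by (subst nn_integral_wishart_law[OF n])
       (simp_all only: k nn_integral_wishart_kernel[OF \<Sigma> matrix_inv_mult n'], measurable)
  also have "\<dots> = ennreal (1 / (det (2 *\<^sub>R \<Sigma>) powr (n / 2) * ?G) * (det \<Sigma> powr (n / 2) * ?G))"
    using G by (simp add: ennreal_mult[symmetric])
  also have "det (2 *\<^sub>R \<Sigma>) powr (n / 2) = 2 powr (n * real CARD('p) / 2) * det \<Sigma> powr (n / 2)"
    using d by (simp add: det_scaleR powr_mult powr_powr mult.commute flip: powr_realpow)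
  also have "1 / (2 powr (n * real CARD('p) / 2) * det \<Sigma> powr (n / 2) * ?G) * (det \<Sigma> powr (n / 2) * ?G) =
      2 powr (- (n * real CARD('p) / 2))"
    using G d by (simp add: powr_minus_divide)
  finally show ?thesis .
qed

lemma wishart_law_inj:
  assumes "real CARD('p) - 1 < n" "real CARD('p) - 1 < m" "wishart_law \<Sigma> n = wishart_law \<Sigma> m"
  shows "n = m"
proof -
  have "ennreal (2 powr (- (n * real CARD('p) / 2))) = ennreal (2 powr (- (m * real CARD('p) / 2)))"
    using assms by (simp only: wishart_law_laplace[symmetric])
  then have "- (n * real CARD('p) / 2) = - (m * real CARD('p) / 2)"
    by (simp add: powr_inj)
  then show ?thesis by simp
qed

text \<open>Independence makes the law of the sum the convolution of the laws.
  \<open>sym_lborel\<close> and \<open>borel\<close> have the same measurable sets, so either may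
  serve as target space of the image measure.\<close>

lemma wishart_distributed_add:
  assumes W: "wishart_distributed M W\<^sub>1 n \<Sigma>" "wishart_distributed M W\<^sub>2 m \<Sigma>"
    and nm: "real CARD('p) - 1 < n" "real CARD('p) - 1 < m"
    and indep: "prob_space.indep_var M borel W\<^sub>1 borel W\<^sub>2"
  shows "wishart_distributed M (\<lambda>\<omega>. W\<^sub>1 \<omega> + W\<^sub>2 \<omega>) (n + m) \<Sigma>"
proof -
  interpret prob_space M using W(1) by (simp add: wishart_distributed_def)
  have law: "W \<in> borel_measurable M \<and> distr M borel W = wishart_law \<Sigma> l"
    if "wishart_distributed M W l \<Sigma>" for W l
  proof -
    have "distr M borel W = distr M sym_lborel W" by (rule distr_cong) simp_all
    then show ?thesis
      using that by (auto simp: wishart_distributed_def distributed_def wishart_law_def cong: measurable_cong_sets)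
  qed
  have [measurable]: "W\<^sub>1 \<in> borel_measurable M" "W\<^sub>2 \<in> borel_measurable M"
    using W law by auto
  have "distr M sym_lborel (\<lambda>\<omega>. W\<^sub>1 \<omega> + W\<^sub>2 \<omega>) = distr M borel (\<lambda>\<omega>. W\<^sub>1 \<omega> + W\<^sub>2 \<omega>)"
    by (rule distr_cong) simp_all
  also have "\<dots> = wishart_law \<Sigma> (n + m)"
    using law[OF W(1)] law[OF W(2)] sum_indep_random_variable[OF indep]
    by (simp add: convolution_wishart_law[OF nm])
  finally have "distributed M sym_lborel (\<lambda>\<omega>. W\<^sub>1 \<omega> + W\<^sub>2 \<omega>) (\<lambda>X. ennreal (wishart_density \<Sigma> (n + m) X))"
    by (simp add: distributed_def wishart_law_def cong: measurable_cong_sets)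
  then show ?thesis
    using W by (auto simp: wishart_distributed_def intro: pos_semidef_add)
qed

end

section \<open>The semigroup of Wishart laws\<close>

theorem lemma1:
  fixes \<Sigma> :: "real^'p^'p" and N :: "real set"
  assumes "pos_def \<Sigma>"
    and "N = {real CARD('p)..} \<or> N = real ` {CARD('p)..}"
  shows "(\<forall>(M :: 'a measure) W\<^sub>1 W\<^sub>2.
            W\<^sub>1 \<in> wishart_matrices M \<Sigma> N \<longrightarrow> W\<^sub>2 \<in> wishart_matrices M \<Sigma> N \<longrightarrow>
            prob_space.indep_var M borel W\<^sub>1 borel W\<^sub>2 \<longrightarrow>
            (\<lambda>\<omega>. W\<^sub>1 \<omega> + W\<^sub>2 \<omega>) \<in> wishart_matrices M \<Sigma> N)
         \<and> comm_semigroup_on (wishart_laws \<Sigma> N) convolution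
         \<and> \<not> unital_on (wishart_laws \<Sigma> N) convolution"
proof -
  have large: "real CARD('p) - 1 < n" "0 < n" if "n \<in> N" for n
  proof -
    have "real CARD('p) \<le> n" "0 < real CARD('p)"
      using assms(2) that by auto
    then show "real CARD('p) - 1 < n" "0 < n" by linarith+
  qed
  \<comment> \<open>Both readings of the parameter range, real and integer degrees of freedom, are
    closed under addition.\<close>
  have add: "n + m \<in> N" if n: "n \<in> N" and m: "m \<in> N" for n m
    using assms(2)
  proof
    assume "N = {real CARD('p)..}"
    then show ?thesis using n large(2)[OF m] by auto
  next
    assume N: "N = real ` {CARD('p)..}"
    then obtain i j where "n = real i" "m = real j" "CARD('p) \<le> i"
      using n m by auto
    then show ?thesis unfolding N by (intro image_eqI[of _ _ "i + j"]) auto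
  qed
  have conv: "convolution (wishart_law \<Sigma> n) (wishart_law \<Sigma> m) = wishart_law \<Sigma> (n + m)"
    if "n \<in> N" "m \<in> N" for n m
    using convolution_wishart_law[OF assms(1)] large that by blast
  have "\<forall>(M :: 'a measure) W\<^sub>1 W\<^sub>2.
            W\<^sub>1 \<in> wishart_matrices M \<Sigma> N \<longrightarrow> W\<^sub>2 \<in> wishart_matrices M \<Sigma> N \<longrightarrow>
            prob_space.indep_var M borel W\<^sub>1 borel W\<^sub>2 \<longrightarrow>
            (\<lambda>\<omega>. W\<^sub>1 \<omega> + W\<^sub>2 \<omega>) \<in> wishart_matrices M \<Sigma> N"
    unfolding wishart_matrices_def mem_Collect_eq
    using wishart_distributed_add[OF assms(1)] large add by blast
  moreover have "comm_semigroup_on (wishart_laws \<Sigma> N) convolution"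
    unfolding comm_semigroup_on_def wishart_laws_def
    \<comment> \<open>Through \<open>conv\<close> the semigroup laws reduce to those of addition of
      the parameters.\<close>
    by (auto simp: conv add ac_simps)
  moreover have "\<not> unital_on (wishart_laws \<Sigma> N) convolution"
  proof
    assume "unital_on (wishart_laws \<Sigma> N) convolution"
    then obtain n where n: "n \<in> N" "convolution (wishart_law \<Sigma> n) (wishart_law \<Sigma> n) = wishart_law \<Sigma> n"
      by (auto simp: unital_on_def wishart_laws_def)
    \<comment> \<open>The identity element combined with itself is an idempotent law; injectivity
      carries this over to its positive parameter.\<close>
    then have "wishart_law \<Sigma> (n + n) = wishart_law \<Sigma> n" by (simp add: conv)
    then have "n + n = n"
      by (rule wishart_law_inj[OF assms(1) large(1)[OF add[OF n(1) n(1)]] large(1)[OF n(1)]])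
    then show False using large(2)[OF n(1)] by simp
  qed
  ultimately show ?thesis by blast
qed

end
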